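(* Let $\Gamma$ be the cyclic group of order $2$, let $(\tilde G,\tilde p)$ be a $\mathcal{C}_2$-symmetric framework in $\mathbb{R}^2$ (where $\mathcal{C}_2=\{\mathrm{id},C_2\}$, $C_2$ the rotation by $\pi$ about the origin) with $\mathcal{C}_2$-gain framework $(G,\psi,p)$. Then: (1) if $(\tilde G,\tilde p)$ is fully-symmetrically isostatic (i.e. $\rho_0$-symmetrically isostatic), then $(G,\psi)$ is $(2,0,3,1)$-gain-tight; (2) if $(\tilde G,\tilde p)$ is anti-symmetrically isostatic (i.e. $\rho_1$-symmetrically isostatic), then $(G,\psi)$ is $(2,2,3,2)$-gain-tight.
   Context: **Frameworks and symmetry.** A framework in $\mathbb{R}^2$ is a pair $(\tilde G,\tilde p)$ with $\tilde G$ a finite simple graph and $\tilde p:V(\tilde G)\to\mathbb{R}^2$ injective; it is assumed that $\tilde p(V(\tilde G))$ affinely spans $\mathbb{R}^2$. $\Gamma=\langle\gamma\rangle$ acts on $\tilde G$ by automorphisms and $\tau:\Gamma\to O(\mathbb{R}^2)$ is the faithful representation with image $\mathcal{C}_2$; $\mathcal{C}_2$-symmetric means $\tau(g)\tilde p(v)=\tilde p(gv)$ for all $g\in\Gamma$, $v\in V(\tilde G)$. A vertex is fixed if it is fixed by all of $\Gamma$ (hence placed at the origin; there is at most one), free if its stabiliser is trivial. The rigidity map $R$ sends $m:V(\tilde G)\to\mathbb{C}^2$ to the function $\{u,v\}\mapsto(\tilde p(u)-\tilde p(v))^T(m(u)-m(v))$ on $E(\tilde G)$; $m$ is an infinitesimal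 motion if $Rm=0$, and trivial if $m(u)=M\tilde p(u)+t$ for a fixed skew-symmetric matrix $M$ and vector $t$ (complex entries). **$\rho_j$-symmetrically isostatic.** For $j=0,1$ let $\rho_j(\gamma)=(-1)^j$, $V^j=\{m:V(\tilde G)\to\mathbb{C}^2\mid m(gv)=\overline{\rho_j(g)}\,\tau(g)m(v)\ \forall g,v\}$ and $W^j=\{w:E(\tilde G)\to\mathbb{C}\mid w(ge)=\overline{\rho_j(g)}\,w(e)\ \forall g,e\}$. Then $R$ maps $V^j$ into $W^j$; the block $\tilde R_j(\tilde G,\tilde p)$ of the rigidity matrix is a matrix of $R|_{V^j}:V^j\to W^j$ (rows correspond to a basis of $W^j$). Thus $\tilde R_0$ has one row for each edge orbit of $\tilde G$, while $\tilde R_1$ has one row for each edge orbit with trivial stabiliser (edges fixed by $\gamma$ contribute no row to $\tilde R_1$). A motion is $\rho_j$-symmetric if it lies in $V^j$. $(\tilde G,\tilde p)$ is $\rho_j$-symmetrically isostatic if all its $\rho_j$-symmetric infinitesimal motions are trivial and $\tilde R_j(\tilde G,\tilde p)$ has no non-trivial row dependence. **Quotient gain graph.** $G=\tilde G/\Gamma$ is the multigraph whose vertices and edges are the vertex orbits and edge orbits of $\tilde G$; $V_0(G)$ and $\overline{V(G)}$ are the sets of orbits of fixed and of free vertices (fixed and free vertices of $G$). Choose a representative $v^\star$ of each vertex orbit $v$ and an orientation of each edge of $G$. The gain $\psi(e)\in\Gamma$ of $e=(u,v)$ is: the unique $g$ with $\{u^\star,gv^\star\}\in e$ if $u,v$ are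 both free; arbitrary if exactly one of $u,v$ is fixed. Put $p(v)=\tilde p(v^\star)$; $(G,\psi,p)$ is the gain framework. **Sparsity.** For a subgraph $H$ of $G$, $V_0(H)=V(H)\cap V_0(G)$, $\overline{V(H)}=V(H)\cap\overline{V(G)}$. The gain of a walk is the product of $\psi(e)^{\pm1}$ along it (sign according to orientation). $H$ is balanced if, after deleting all fixed vertices and their incident edges, every cycle (including loops and 2-cycles of parallel edges) has gain $\mathrm{id}$. $(G,\psi)$ is $(2,m,3,l)$-gain-sparse if $|E(H)|\le2|V(H)|-3$ for every balanced subgraph $H$ with $E(H)\ne\emptyset$ and $|E(H)|\le2|\overline{V(H)}|+m|V_0(H)|-l$ for every subgraph $H$ with $E(H)\ne\emptyset$; it is $(2,m,3,l)$-gain-tight if moreover $|E(G)|=2|\overline{V(G)}|+m|V_0(G)|-l$.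
   Formalization: Part (2) additionally assumes that no edge of G̃ is fixed by γ; without this it is false, since a fixed edge contributes no row to the anti-symmetric block but is a loop at a free vertex of G, which violates (2,2,3,2)-gain-sparsity. *)

theory Defs
  imports
    "HOL-Analysis.Analysis"
    "HOL-Library.Function_Algebras"
    "HOL-Algebra.Group_Action"
    "Graph_Theory.Digraph_Component"
    "Graph_Theory.Arc_Walk"
begin

section \<open>Symmetric frameworks\<close>

text \<open>The rotation matrices generated by the half turn about the origin.\<close>

definition C2_matrices :: "(real^2^2) set" where
  "C2_matrices = {mat 1, vector [vector [cos pi, - sin pi], vector [sin pi, cos pi]]}"

definition simple_graph :: "'v set \<Rightarrow> 'v set set \<Rightarrow> bool" where
  "simple_graph V E \<longleftrightarrow> finite V \<and> (\<forall>e\<in>E. e \<subseteq> V \<and> card e = 2)"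

definition edge_action :: "('g \<Rightarrow> 'v \<Rightarrow> 'v) \<Rightarrow> 'g \<Rightarrow> 'v set \<Rightarrow> 'v set" where
  "edge_action \<phi> g e = \<phi> g ` e"

definition C2_symmetric_framework ::
  "'g monoid \<Rightarrow> ('g \<Rightarrow> 'v \<Rightarrow> 'v) \<Rightarrow> ('g \<Rightarrow> real^2^2) \<Rightarrow> 'v set \<Rightarrow> 'v set set \<Rightarrow> ('v \<Rightarrow> real^2) \<Rightarrow> bool"
where
  "C2_symmetric_framework \<Gamma> \<phi> \<tau> V E pt \<longleftrightarrow>
     simple_graph V E
   \<and> group_action \<Gamma> V \<phi> \<and> (\<forall>g\<in>carrier \<Gamma>. \<forall>e\<in>E. edge_action \<phi> g e \<in> E)
   \<and> (\<forall>g\<in>carrier \<Gamma>. \<forall>h\<in>carrier \<Gamma>. \<tau> (g \<otimes>\<^bsub>\<Gamma>\<^esub> h) = \<tau> g ** \<tau> h)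
   \<and> inj_on \<tau> (carrier \<Gamma>) \<and> \<tau> ` carrier \<Gamma> = C2_matrices
   \<and> inj_on pt V \<and> affine hull (pt ` V) = UNIV
   \<and> (\<forall>g\<in>carrier \<Gamma>. \<forall>v\<in>V. \<tau> g *v pt v = pt (\<phi> g v))"

definition fixed_vertex :: "'g monoid \<Rightarrow> ('g \<Rightarrow> 'v \<Rightarrow> 'v) \<Rightarrow> 'v \<Rightarrow> bool" where
  "fixed_vertex \<Gamma> \<phi> v \<longleftrightarrow> stabilizer \<Gamma> \<phi> v = carrier \<Gamma>"

definition free_vertex :: "'g monoid \<Rightarrow> ('g \<Rightarrow> 'v \<Rightarrow> 'v) \<Rightarrow> 'v \<Rightarrow> bool" where
  "free_vertex \<Gamma> \<phi> v \<longleftrightarrow> stabilizer \<Gamma> \<phi> v = {\<one>\<^bsub>\<Gamma>\<^esub>}"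


section \<open>Infinitesimal motions and the blocks of the rigidity matrix\<close>

abbreviation cvec :: "real^2 \<Rightarrow> complex^2" where
  "cvec x \<equiv> (\<chi> i. complex_of_real (x $ i))"

abbreviation cmat :: "real^2^2 \<Rightarrow> complex^2^2" where
  "cmat A \<equiv> map_matrix complex_of_real A"

text \<open>
  Functions on the vertex set (edge set) are represented by functions on the whole type that
  vanish outside that set. The spaces of motions and of edge weights are complex vector spaces.
\<close>

definition mscale :: "complex \<Rightarrow> ('v \<Rightarrow> complex^2) \<Rightarrow> 'v \<Rightarrow> complex^2" where
  "mscale c m = (\<lambda>v. c *s m v)"

definition wscale :: "complex \<Rightarrow> ('e \<Rightarrow> complex) \<Rightarrow> 'e \<Rightarrow> complex" where
  "wscale c w = (\<lambda>e. c * w e)"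

global_interpretation mot: vector_space "mscale :: complex \<Rightarrow> ('v \<Rightarrow> complex^2) \<Rightarrow> 'v \<Rightarrow> complex^2"
  by unfold_locales (auto simp: mscale_def fun_eq_iff vec_eq_iff algebra_simps)

global_interpretation wgt: vector_space "wscale :: complex \<Rightarrow> ('e \<Rightarrow> complex) \<Rightarrow> 'e \<Rightarrow> complex"
  by unfold_locales (auto simp: wscale_def fun_eq_iff algebra_simps)

text \<open>
  The value at an edge is \<open>(p(u) - p(v))\<^sup>T (m(u) - m(v))\<close>, a bilinear expression (no complex
  conjugation) that does not depend on the order of the two end vertices.
\<close>

definition rigidity_map ::
  "'v set set \<Rightarrow> ('v \<Rightarrow> real^2) \<Rightarrow> ('v \<Rightarrow> complex^2) \<Rightarrow> 'v set \<Rightarrow> complex"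
where
  "rigidity_map E pt m e =
     (if e \<in> E
      then THE x. \<exists>u v. e = {u, v} \<and> x = (\<Sum>i\<in>UNIV. cvec (pt u - pt v) $ i * (m u - m v) $ i)
      else 0)"

definition infinitesimal_motion ::
  "'v set set \<Rightarrow> ('v \<Rightarrow> real^2) \<Rightarrow> ('v \<Rightarrow> complex^2) \<Rightarrow> bool"
where
  "infinitesimal_motion E pt m \<longleftrightarrow> (\<forall>e\<in>E. rigidity_map E pt m e = 0)"

definition trivial_motion ::
  "'v set \<Rightarrow> ('v \<Rightarrow> real^2) \<Rightarrow> ('v \<Rightarrow> complex^2) \<Rightarrow> bool"
where
  "trivial_motion V pt m \<longleftrightarrow>
     (\<exists>(M :: complex^2^2) (t :: complex^2). transpose M = - M \<and> (\<forall>u\<in>V. m u = M *v cvec (pt u) + t))"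

definition rho :: "'g monoid \<Rightarrow> nat \<Rightarrow> 'g \<Rightarrow> complex" where
  "rho \<Gamma> j g = (if g = \<one>\<^bsub>\<Gamma>\<^esub> then 1 else (- 1) ^ j)"

definition symmetric_motions ::
  "'g monoid \<Rightarrow> ('g \<Rightarrow> 'v \<Rightarrow> 'v) \<Rightarrow> ('g \<Rightarrow> real^2^2) \<Rightarrow> 'v set \<Rightarrow> nat \<Rightarrow> ('v \<Rightarrow> complex^2) set"
where
  "symmetric_motions \<Gamma> \<phi> \<tau> V j =
     {m. (\<forall>v. v \<notin> V \<longrightarrow> m v = 0) \<and>
         (\<forall>g\<in>carrier \<Gamma>. \<forall>v\<in>V. m (\<phi> g v) = cnj (rho \<Gamma> j g) *s (cmat (\<tau> g) *v m v))}"

definition symmetric_weights ::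
  "'g monoid \<Rightarrow> ('g \<Rightarrow> 'v \<Rightarrow> 'v) \<Rightarrow> 'v set set \<Rightarrow> nat \<Rightarrow> ('v set \<Rightarrow> complex) set"
where
  "symmetric_weights \<Gamma> \<phi> E j =
     {w. (\<forall>e. e \<notin> E \<longrightarrow> w e = 0) \<and>
         (\<forall>g\<in>carrier \<Gamma>. \<forall>e\<in>E. w (edge_action \<phi> g e) = cnj (rho \<Gamma> j g) * w e)}"

text \<open>
  The matrix of the rigidity map with respect to a basis \<open>BV\<close> of the space of symmetric motions
  (columns) and a basis \<open>BW\<close> of the space of symmetric edge weights (rows).
\<close>

definition block_matrix ::
  "'v set set \<Rightarrow> ('v \<Rightarrow> real^2) \<Rightarrow> ('v set \<Rightarrow> complex) set
    \<Rightarrow> ('v set \<Rightarrow> complex) \<Rightarrow> ('v \<Rightarrow> complex^2) \<Rightarrow> complex"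
where
  "block_matrix E pt BW w b = wgt.representation BW (rigidity_map E pt b) w"

definition no_row_dependence :: "'r set \<Rightarrow> 'c set \<Rightarrow> ('r \<Rightarrow> 'c \<Rightarrow> complex) \<Rightarrow> bool" where
  "no_row_dependence I J A \<longleftrightarrow>
     (\<forall>c :: 'r \<Rightarrow> complex. (\<forall>j\<in>J. (\<Sum>i\<in>I. c i * A i j) = 0) \<longrightarrow> (\<forall>i\<in>I. c i = 0))"

text \<open>
  Row independence of the block does not depend on the bases, so it is required for some choice.
  In the anti-symmetric case \<open>j = 1\<close> every symmetric edge weight vanishes at an edge
  fixed by the group, so such an edge contributes no row.
\<close>

definition symmetrically_isostatic ::
  "'g monoid \<Rightarrow> ('g \<Rightarrow> 'v \<Rightarrow> 'v) \<Rightarrow> ('g \<Rightarrow> real^2^2) \<Rightarrow> 'v set \<Rightarrow> 'v set set \<Rightarrow> ('v \<Rightarrow> real^2)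
    \<Rightarrow> nat \<Rightarrow> bool"
where
  "symmetrically_isostatic \<Gamma> \<phi> \<tau> V E pt j \<longleftrightarrow>
     (\<forall>m \<in> symmetric_motions \<Gamma> \<phi> \<tau> V j. infinitesimal_motion E pt m \<longrightarrow> trivial_motion V pt m)
   \<and> (\<exists>BV BW.
        mot.independent BV \<and> mot.span BV = symmetric_motions \<Gamma> \<phi> \<tau> V j
      \<and> wgt.independent BW \<and> wgt.span BW = symmetric_weights \<Gamma> \<phi> E j
      \<and> no_row_dependence BW BV (block_matrix E pt BW))"


section \<open>Quotient gain graphs\<close>

text \<open>
  The quotient multigraph is a directed multigraph whose vertices and arcs are the vertex orbits
  and edge orbits; \<open>tail\<close> and \<open>head\<close> record the chosen orientation, \<open>rep\<close> the chosen orbit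
  representatives. An edge whose end vertices are interchanged by the group becomes a loop.
  If exactly one end vertex is fixed, the gain is an arbitrary element of the group.
\<close>

definition gain_framework ::
  "'g monoid \<Rightarrow> ('g \<Rightarrow> 'v \<Rightarrow> 'v) \<Rightarrow> 'v set \<Rightarrow> 'v set set \<Rightarrow> ('v \<Rightarrow> real^2)
    \<Rightarrow> ('v set, 'v set set) pre_digraph \<Rightarrow> ('v set \<Rightarrow> 'v) \<Rightarrow> ('v set set \<Rightarrow> 'g) \<Rightarrow> ('v set \<Rightarrow> real^2)
    \<Rightarrow> bool"
where
  "gain_framework \<Gamma> \<phi> V E pt G rep \<psi> p \<longleftrightarrow>
     verts G = orbits \<Gamma> V \<phi>
   \<and> arcs G = orbits \<Gamma> E (edge_action \<phi>)
   \<and> (\<forall>a\<in>arcs G. \<exists>u v. {u, v} \<in> a \<and> tail G a = orbit \<Gamma> \<phi> u \<and> head G a = orbit \<Gamma> \<phi> v)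
   \<and> (\<forall>x\<in>verts G. rep x \<in> x)
   \<and> (\<forall>a\<in>arcs G. \<psi> a \<in> carrier \<Gamma> \<and>
        (free_vertex \<Gamma> \<phi> (rep (tail G a)) \<and> free_vertex \<Gamma> \<phi> (rep (head G a)) \<longrightarrow>
           {rep (tail G a), \<phi> (\<psi> a) (rep (head G a))} \<in> a))
   \<and> (\<forall>x\<in>verts G. p x = pt (rep x))"

definition fixed_orbits :: "'g monoid \<Rightarrow> ('g \<Rightarrow> 'v \<Rightarrow> 'v) \<Rightarrow> 'v set \<Rightarrow> 'v set set" where
  "fixed_orbits \<Gamma> \<phi> V = {orbit \<Gamma> \<phi> v | v. v \<in> V \<and> fixed_vertex \<Gamma> \<phi> v}"

definition free_orbits :: "'g monoid \<Rightarrow> ('g \<Rightarrow> 'v \<Rightarrow> 'v) \<Rightarrow> 'v set \<Rightarrow> 'v set set" where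
  "free_orbits \<Gamma> \<phi> V = {orbit \<Gamma> \<phi> v | v. v \<in> V \<and> free_vertex \<Gamma> \<phi> v}"

text \<open>
  Walks in the underlying undirected multigraph are directed walks in the following digraph, in
  which \<open>(a, True)\<close> traverses the arc \<open>a\<close> along its orientation and \<open>(a, False)\<close> against it.
\<close>

definition both_ways :: "('x, 'a) pre_digraph \<Rightarrow> ('x, 'a \<times> bool) pre_digraph" where
  "both_ways H = \<lparr> verts = verts H, arcs = arcs H \<times> UNIV,
     tail = (\<lambda>(a, d). if d then tail H a else head H a),
     head = (\<lambda>(a, d). if d then head H a else tail H a) \<rparr>"

text \<open>
  Distinctness of the underlying edges excludes going back and forth along one edge, while loops
  and pairs of parallel edges are cycles.
\<close>

definition undirected_cycle :: "('x, 'a) pre_digraph \<Rightarrow> ('a \<times> bool) list \<Rightarrow> bool" where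
  "undirected_cycle H w \<longleftrightarrow> pre_digraph.cycle (both_ways H) w \<and> distinct (map fst w)"

fun walk_gain :: "'g monoid \<Rightarrow> ('a \<Rightarrow> 'g) \<Rightarrow> ('a \<times> bool) list \<Rightarrow> 'g" where
  "walk_gain \<Gamma> \<psi> [] = \<one>\<^bsub>\<Gamma>\<^esub>"
| "walk_gain \<Gamma> \<psi> ((a, d) # w) = (if d then \<psi> a else inv\<^bsub>\<Gamma>\<^esub> \<psi> a) \<otimes>\<^bsub>\<Gamma>\<^esub> walk_gain \<Gamma> \<psi> w"

text \<open>Below, \<open>X0\<close> and \<open>X1\<close> are the sets of fixed and of free vertices of the gain graph.\<close>

definition balanced ::
  "'g monoid \<Rightarrow> ('a \<Rightarrow> 'g) \<Rightarrow> 'x set \<Rightarrow> ('x, 'a) pre_digraph \<Rightarrow> bool"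
where
  "balanced \<Gamma> \<psi> X0 H \<longleftrightarrow>
     (\<forall>w. undirected_cycle (H \<restriction> (verts H - X0)) w \<longrightarrow> walk_gain \<Gamma> \<psi> w = \<one>\<^bsub>\<Gamma>\<^esub>)"

text \<open>
  In \<open>(k,m,h,l)\<close>-gain-sparsity, \<open>k\<close> is the weight of free vertices, \<open>m\<close> that of fixed vertices,
  \<open>h\<close> the deficit of balanced subgraphs (where all vertices have weight \<open>k\<close>) and \<open>l\<close> the deficit
  of arbitrary subgraphs.
\<close>

definition gain_sparse ::
  "'g monoid \<Rightarrow> ('x, 'a) pre_digraph \<Rightarrow> ('a \<Rightarrow> 'g) \<Rightarrow> 'x set \<Rightarrow> 'x set
    \<Rightarrow> int \<Rightarrow> int \<Rightarrow> int \<Rightarrow> int \<Rightarrow> bool"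
where
  "gain_sparse \<Gamma> G \<psi> X0 X1 k m h l \<longleftrightarrow>
     (\<forall>H. subgraph H G \<and> arcs H \<noteq> {} \<longrightarrow>
        (balanced \<Gamma> \<psi> X0 H \<longrightarrow> int (card (arcs H)) \<le> k * int (card (verts H)) - h)
      \<and> int (card (arcs H)) \<le>
          k * int (card (verts H \<inter> X1)) + m * int (card (verts H \<inter> X0)) - l)"

definition gain_tight ::
  "'g monoid \<Rightarrow> ('x, 'a) pre_digraph \<Rightarrow> ('a \<Rightarrow> 'g) \<Rightarrow> 'x set \<Rightarrow> 'x set
    \<Rightarrow> int \<Rightarrow> int \<Rightarrow> int \<Rightarrow> int \<Rightarrow> bool"
where
  "gain_tight \<Gamma> G \<psi> X0 X1 k m h l \<longleftrightarrow>
     gain_sparse \<Gamma> G \<psi> X0 X1 k m h l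
   \<and> int (card (arcs G)) =
       k * int (card (verts G \<inter> X1)) + m * int (card (verts G \<inter> X0)) - l"

text \<open>
  An edge fixed by the group is an arc (a loop at a free vertex) of the quotient graph but gives no
  row of the anti-symmetric block. It can be added to an anti-symmetrically isostatic framework
  without affecting isostaticity, while a \<open>(2,2,3,2)\<close>-gain-sparse graph has no such loop. So an
  anti-symmetrically isostatic framework can only have a \<open>(2,2,3,2)\<close>-gain-tight gain graph if
  no edge is fixed.
\<close>

definition no_fixed_edges :: "'g monoid \<Rightarrow> ('g \<Rightarrow> 'v \<Rightarrow> 'v) \<Rightarrow> 'v set set \<Rightarrow> bool" where
  "no_fixed_edges \<Gamma> \<phi> E \<longleftrightarrow> (\<forall>e\<in>E. stabilizer \<Gamma> (edge_action \<phi>) e = {\<one>\<^bsub>\<Gamma>\<^esub>})"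

end

theory Submission
  imports Defs
begin

text \<open>
  Row independence provides, for every edge orbit, a symmetric motion that stretches it alone.
  Together with the trivial motions these remain linearly independent when restricted to a set of
  representatives of the vertices of a subgraph, so an underdetermined linear system would arise
  if the subgraph had too many edges. The symmetric trivial motions are the rotations for \<open>j = 0\<close>
  and the translations for \<open>j = 1\<close>. A balanced subgraph lifts, after switching the
  representatives, to a copy on which the symmetry imposes no condition, so all three dimensions
  of trivial motions count. Conversely, too few edges would leave room for a non-trivial symmetric
  motion.
\<close>

section \<open>Underdetermined systems and dual families\<close>

text \<open>Both directions are a contest between numbers of unknowns and equations, without ranks.
  For upper bounds the unknowns are coefficients of edge motions and trivial motions and the
  equations are coordinates at representatives; for the lower bound the coordinates are the
  unknowns. The constants come from the sign \<open>\<kappa>\<close> by which the half turn acts. At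
  a fixed vertex a symmetric motion satisfies \<open>m = \<kappa> m\<close>: it vanishes for
  \<open>\<kappa> = - 1\<close> and is arbitrary for \<open>\<kappa> = 1\<close>, hence the weights
  0 and 2 of fixed vertices. Rotational velocity is odd in the position and a translation is
  constant, hence the deficits 1 and 2. The balanced bound ignores these constants although the edge
  motions come from the symmetric block. This works because only their stretching values on the
  lifted copy enter the count, so their combinations with trivial motions may leave the symmetric
  space. For \<open>\<kappa> = 1\<close> a symmetric weight at a fixed edge equals its own negative;
  no symmetric motion stretches such an edge, and it would have no dual motion.\<close>

lemma underdetermined_system:
  fixes A :: "'i \<Rightarrow> 't \<Rightarrow> 'a::field"
  assumes "finite T" and "card T < card I"
  shows "\<exists>c. (\<exists>i\<in>I. c i \<noteq> 0) \<and> (\<forall>t\<in>T. (\<Sum>i\<in>I. c i * A i t) = 0)"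
  using assms
proof (induction T arbitrary: I A rule: finite_induct)
  case empty
  then have "I \<noteq> {}" by auto
  then show ?case by (intro exI[of _ "\<lambda>_. 1"]) auto
next
  case (insert t T)
  have fin: "finite I" using insert.prems by (intro card_ge_0_finite) simp
  show ?case
  proof (cases "\<forall>i\<in>I. A i t = 0")
    case True
    have "card T < card I" using insert by simp
    from insert.IH[OF this, of A] True show ?thesis by auto
  next
    case False
    then obtain j where j: "j \<in> I" "A j t \<noteq> 0" by auto
    define J where "J = I - {j}"
    \<comment> \<open>Gaussian elimination: equation \<open>t\<close> is solved for the unknown
      \<open>j\<close> and substituted into the others. Below, \<open>d\<close> gives
      \<open>j\<close> the value that equation \<open>t\<close> demands.\<close>
    define B where "B i s = A i s - A i t / A j t * A j s" for i s
    have "card T < card J" using insert j fin by (simp add: J_def)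
    from insert.IH[OF this, of B] obtain c
      where c: "\<exists>i\<in>J. c i \<noteq> 0" "\<forall>s\<in>T. (\<Sum>i\<in>J. c i * B i s) = 0" by blast
    define d where "d = c(j := - (\<Sum>i\<in>J. c i * A i t) / A j t)"
    have split: "(\<Sum>i\<in>I. d i * A i s) = d j * A j s + (\<Sum>i\<in>J. c i * A i s)" for s
    proof -
      have "(\<Sum>i\<in>I. d i * A i s) = d j * A j s + (\<Sum>i\<in>J. d i * A i s)"
        unfolding J_def using fin j by (simp add: sum.remove)
      also have "(\<Sum>i\<in>J. d i * A i s) = (\<Sum>i\<in>J. c i * A i s)"
        by (rule sum.cong) (auto simp: J_def d_def)
      finally show ?thesis .
    qed
    have "(\<Sum>i\<in>I. d i * A i s) = 0" if "s \<in> insert t T" for s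
    proof (cases "s = t")
      case True
      then show ?thesis unfolding split using j by (simp add: d_def)
    next
      case False
      then have "0 = (\<Sum>i\<in>J. c i * B i s)" using c that by simp
      also have "\<dots> = (\<Sum>i\<in>J. c i * A i s) - (\<Sum>i\<in>J. c i * A i t) / A j t * A j s"
        by (simp add: B_def right_diff_distrib sum_subtractf sum_distrib_right sum_divide_distrib mult.assoc)
      finally show ?thesis unfolding split by (simp add: d_def)
    qed
    moreover have "\<exists>i\<in>I. d i \<noteq> 0" using c(1) by (auto simp: J_def d_def)
    ultimately show ?thesis by blast
  qed
qed

text \<open>If \<open>l k\<close> vanished on the common kernel in \<open>U\<close> of the other
  functionals, it would be a combination of them on \<open>U\<close>. So some vector of that kernel
  has a nonzero value; scaled, it is dual to \<open>k\<close> and serves to correct the earlier dual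
  vectors.\<close>

lemma (in vector_space) dual_family_exists:
  fixes l :: "'i \<Rightarrow> 'b \<Rightarrow> 'a"
  assumes "finite I" and "subspace U"
    and lin: "\<And>i. i \<in> I \<Longrightarrow> module_hom scale (*) (l i)"
    and indep: "\<And>c. (\<And>u. u \<in> U \<Longrightarrow> (\<Sum>i\<in>I. c i * l i u) = 0) \<Longrightarrow> \<forall>i\<in>I. c i = 0"
  shows "\<exists>b. \<forall>i\<in>I. b i \<in> U \<and> (\<forall>j\<in>I. l j (b i) = (if i = j then 1 else 0))"
  using assms(1) lin indep
proof (induction I rule: finite_induct)
  case empty
  then show ?case by simp
next
  case (insert k I)
  have "\<forall>i\<in>I. c i = 0" if c: "\<And>u. u \<in> U \<Longrightarrow> (\<Sum>i\<in>I. c i * l i u) = 0" for c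
  proof -
    have "(\<Sum>i\<in>insert k I. (c(k := 0)) i * l i u) = (\<Sum>i\<in>I. c i * l i u)" for u
      using insert.hyps by (auto intro!: sum.cong)
    then have "\<forall>i\<in>insert k I. (c(k := 0)) i = 0" using c by (intro insert.prems) simp_all
    then show ?thesis using insert.hyps by (auto split: if_splits)
  qed
  then have "\<exists>b. \<forall>i\<in>I. b i \<in> U \<and> (\<forall>j\<in>I. l j (b i) = (if i = j then 1 else 0))"
    by (intro insert.IH) (auto intro: insert.prems(1))
  then obtain b
    where b: "\<And>i. i \<in> I \<Longrightarrow> b i \<in> U"
      and dual: "\<And>i j. i \<in> I \<Longrightarrow> j \<in> I \<Longrightarrow> l j (b i) = (if i = j then 1 else 0)"
    by auto
  note sc = module_hom.scale[OF insert.prems(1)]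
    and di = module_hom.diff[OF insert.prems(1)] and su = module_hom.sum[OF insert.prems(1)]
  \<comment> \<open>Projection onto the common kernel of the earlier functionals, along their dual
    vectors.\<close>
  define pr where "pr u = u - (\<Sum>i\<in>I. scale (l i u) (b i))" for u
  have prU: "pr u \<in> U" if "u \<in> U" for u
    unfolding pr_def using that b \<open>subspace U\<close>
    by (intro subspace_diff subspace_sum subspace_scale) auto
  have pr0: "l j (pr u) = 0" if "j \<in> I" for j u
  proof -
    have "l j (pr u) = l j u - (\<Sum>i\<in>I. l i u * l j (b i))"
      unfolding pr_def using that by (simp add: di su sc)
    also have "(\<Sum>i\<in>I. l i u * l j (b i)) = (\<Sum>i\<in>I. if i = j then l i u else 0)"
      using dual that by (intro sum.cong) auto
    finally show ?thesis using that insert.hyps by simp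
  qed
  have "\<exists>u\<in>U. l k (pr u) \<noteq> 0"
  proof (rule ccontr)
    assume *: "\<not> ?thesis"
    \<comment> \<open>Expanding \<open>l k (pr u) = 0\<close> gives this dependence, whose
      coefficient at \<open>k\<close> is 1.\<close>
    define c where "c = (\<lambda>i. - l k (b i))(k := 1)"
    have "(\<Sum>i\<in>insert k I. c i * l i u) = 0" if "u \<in> U" for u
    proof -
      have "(\<Sum>i\<in>I. c i * l i u) = - (\<Sum>i\<in>I. l i u * l k (b i))"
        unfolding sum_negf[symmetric] using insert.hyps by (intro sum.cong) (auto simp: c_def)
      moreover have "l k u - (\<Sum>i\<in>I. l i u * l k (b i)) = 0"
        using * that unfolding pr_def by (auto simp: di su sc)
      ultimately show ?thesis using insert.hyps by (simp add: c_def)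
    qed
    from insert.prems(2)[OF this] show False by (simp add: c_def)
  qed
  then obtain u where u: "u \<in> U" "l k (pr u) \<noteq> 0" by auto
  define z where "z = scale (1 / l k (pr u)) (pr u)"
  have z: "z \<in> U" "l k z = 1" "\<And>j. j \<in> I \<Longrightarrow> l j z = 0"
    using u prU pr0 \<open>subspace U\<close> by (auto simp: z_def sc intro: subspace_scale)
  define b' where "b' = (\<lambda>i. b i - scale (l k (b i)) z)(k := z)"
  have "b' i \<in> U" if "i \<in> insert k I" for i
    using that z b \<open>subspace U\<close> by (auto simp: b'_def intro: subspace_diff subspace_scale)
  moreover have "l j (b' i) = (if i = j then 1 else 0)" if "i \<in> insert k I" "j \<in> insert k I" for i j
    using that z insert.hyps by (auto simp: b'_def di sc dual)
  ultimately show ?case by blast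
qed

section \<open>Balanced graphs have potentials\<close>

lemma both_ways_simps [simp]:
  "verts (both_ways H) = verts H" "arcs (both_ways H) = arcs H \<times> UNIV"
  "tail (both_ways H) (a, d) = (if d then tail H a else head H a)"
  "head (both_ways H) (a, d) = (if d then head H a else tail H a)"
  by (simp_all add: both_ways_def)

lemma wf_both_ways: "wf_digraph H \<Longrightarrow> wf_digraph (both_ways H)"
  by (auto simp: wf_digraph_def)

lemma subgraph_both_ways: "subgraph H G \<Longrightarrow> subgraph (both_ways H) (both_ways G)"
  using wf_both_ways[of H] wf_both_ways[of G]
  by (auto simp: subgraph_def compatible_def both_ways_def)

lemma undirected_cycle_subgraph:
  assumes "subgraph H G" and "undirected_cycle H w"
  shows "undirected_cycle G w"
proof -
  have "wf_digraph (both_ways G)" using assms by (auto intro: wf_both_ways)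
  then show ?thesis
    using wf_digraph.subgraph_cycle[OF _ subgraph_both_ways[OF assms(1)]] assms(2)
    by (auto simp: undirected_cycle_def)
qed

lemma arc_ends_in_awalk_verts:
  assumes "pre_digraph.cas (both_ways H) u w v" and "(a, d) \<in> set w"
  shows "{tail H a, head H a} \<subseteq> set (pre_digraph.awalk_verts (both_ways H) u w)"
  using assms
proof (induction w arbitrary: u)
  case Nil
  then show ?case by simp
next
  case (Cons x w)
  obtain b e where x: "x = (b, e)" by (cases x)
  have cas: "pre_digraph.cas (both_ways H) (head (both_ways H) x) w v"
    using Cons.prems by (simp add: pre_digraph.cas.simps)
  have hd: "head (both_ways H) x \<in> set (pre_digraph.awalk_verts (both_ways H) (head (both_ways H) x) w)"
    using cas by (cases w) (auto simp: pre_digraph.cas.simps pre_digraph.awalk_verts.simps)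
  show ?case
  proof (cases "x = (a, d)")
    case True
    then show ?thesis using hd by (auto simp: pre_digraph.awalk_verts.simps split: if_splits)
  next
    case False
    then show ?thesis using Cons.IH[OF cas] Cons.prems
      by (auto simp: pre_digraph.awalk_verts.simps)
  qed
qed

text \<open>A path that uses an edge twice would visit one of its ends twice.\<close>

lemma distinct_edges_of_path:
  assumes "pre_digraph.cas (both_ways H) u w v"
    and "distinct (pre_digraph.awalk_verts (both_ways H) u w)"
  shows "distinct (map fst w)"
  using assms
proof (induction w arbitrary: u)
  case Nil
  then show ?case by simp
next
  case (Cons x w)
  obtain b e where x: "x = (b, e)" by (cases x)
  have cas: "pre_digraph.cas (both_ways H) (head (both_ways H) x) w v"
    using Cons.prems by (simp add: pre_digraph.cas.simps)
  have "b \<notin> fst ` set w"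
  proof
    assume "b \<in> fst ` set w"
    then obtain d where "(b, d) \<in> set w" by auto
    from arc_ends_in_awalk_verts[OF cas this] Cons.prems(2) show False
      by (auto simp: x pre_digraph.awalk_verts.simps split: if_splits)
  qed
  with Cons.IH[OF cas] Cons.prems show ?case by (simp add: x pre_digraph.awalk_verts.simps)
qed

text \<open>The changes of \<open>f\<close> telescope modulo 2. The direction in which an edge is
  traversed is immaterial, since inequality of truth values is symmetric.\<close>

lemma potential_along_walk:
  fixes f :: "'x \<Rightarrow> bool"
  assumes "pre_digraph.cas (both_ways H) u w v"
    and "\<And>a. a \<in> fst ` set w \<Longrightarrow> (f (tail H a) \<noteq> f (head H a)) = b a"
  shows "(f u \<noteq> f v) = odd (length (filter (\<lambda>(a, d). b a) w))"
  using assms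
proof (induction w arbitrary: u)
  case Nil
  then show ?case by (simp add: pre_digraph.cas.simps)
next
  case (Cons x w)
  obtain a e where x: "x = (a, e)" by (cases x)
  have cas: "pre_digraph.cas (both_ways H) (head (both_ways H) x) w v" and u: "tail (both_ways H) x = u"
    using Cons.prems by (simp_all add: pre_digraph.cas.simps)
  have "(f (head (both_ways H) x) \<noteq> f v) = odd (length (filter (\<lambda>(a, d). b a) w))"
    by (rule Cons.IH[OF cas]) (use Cons.prems in auto)
  moreover have "(f u \<noteq> f (head (both_ways H) x)) = b a"
    using Cons.prems(2)[of a] unfolding u[symmetric] by (cases e) (auto simp: x)
  ultimately show ?case by (simp add: x) argo
qed

text \<open>
  Harary's theorem, by induction on the number of edges: a potential of the graph without an edge
  \<open>a\<close> either fits \<open>a\<close>, or can be switched on one component if the ends of \<open>a\<close> become disconnected,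
  or else \<open>a\<close> closes an unbalanced cycle.
\<close>

lemma potential_exists:
  fixes H :: "('x, 'a) pre_digraph" and b :: "'a \<Rightarrow> bool"
  assumes "finite (arcs H)" and "wf_digraph H"
    and "\<And>w. undirected_cycle H w \<Longrightarrow> even (length (filter (\<lambda>(a, d). b a) w))"
  shows "\<exists>f :: 'x \<Rightarrow> bool. \<forall>a\<in>arcs H. (f (tail H a) \<noteq> f (head H a)) = b a"
  using assms
proof (induction "card (arcs H)" arbitrary: H)
  case 0
  then show ?case by auto
next
  case (Suc n)
  then obtain a where a: "a \<in> arcs H" by fastforce
  define H' where "H' = pre_digraph.del_arc H a"
  have H': "verts H' = verts H" "arcs H' = arcs H - {a}" "tail H' = tail H" "head H' = head H"
    by (simp_all add: H'_def pre_digraph.del_arc_simps)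
  have sub: "subgraph H' H" unfolding H'_def by (rule wf_digraph.subgraph_del_arc) fact
  have wf': "wf_digraph H'" using sub by auto
  have "\<exists>f :: 'x \<Rightarrow> bool. \<forall>e\<in>arcs H'. (f (tail H' e) \<noteq> f (head H' e)) = b e"
  proof (rule Suc.hyps(1)[of H'])
    show "n = card (arcs H')" using Suc.hyps(2) a Suc.prems(1) by (simp add: H')
    show "finite (arcs H')" using Suc.prems(1) by (simp add: H')
    show "even (length (filter (\<lambda>(a, d). b a) w))" if "undirected_cycle H' w" for w
      by (rule Suc.prems(3)) (rule undirected_cycle_subgraph[OF sub that])
  qed (rule wf')
  then obtain f :: "'x \<Rightarrow> bool" where f: "\<And>e. e \<in> arcs H \<Longrightarrow> e \<noteq> a \<Longrightarrow> (f (tail H e) \<noteq> f (head H e)) = b e"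
    by (auto simp: H')
  interpret B: wf_digraph "both_ways H'" by (rule wf_both_ways[OF wf'])
  interpret BH: wf_digraph "both_ways H" by (rule wf_both_ways[OF Suc.prems(2)])
  let ?x = "head H a" and ?y = "tail H a"
  have ends: "?x \<in> verts H" "?y \<in> verts H" using a Suc.prems(2) by (simp_all add: wf_digraph_def)
  show ?case
  proof (cases "?x \<rightarrow>\<^sup>*\<^bsub>both_ways H'\<^esub> ?y")
    case True
    then obtain w where w: "B.apath ?x w ?y" using B.reachable_apath by blast
    then have cas: "B.cas ?x w ?y" and aw: "B.awalk ?x w ?y"
      and dist: "distinct (B.awalk_verts ?x w)"
      by (auto simp: B.apath_def)
    have set_w: "fst ` set w \<subseteq> arcs H - {a}" using aw unfolding B.awalk_def by (force simp: H')
    have sub': "subgraph (both_ways H') (both_ways H)" by (rule subgraph_both_ways[OF sub])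
    have "BH.apath ?x w ?y" by (rule BH.subgraph_apath_imp_apath[OF w sub'])
    then have aw_H: "BH.awalk ?x w ?y" and dist_H: "distinct (BH.awalk_verts ?x w)"
      by (auto simp: BH.apath_def)
    \<comment> \<open>If \<open>a\<close> is a loop, then \<open>w\<close> is empty and the cycle
      consists of \<open>a\<close> alone.\<close>
    have "BH.cycle ((a, True) # w)"
      unfolding BH.cycle_def
    proof (intro exI[of _ ?y] conjI)
      show "BH.awalk ?y ((a, True) # w) ?y" using aw_H a ends by (auto simp: BH.awalk_Cons_iff)
    qed (use dist_H in simp_all)
    moreover have "distinct (map fst ((a, True) # w))"
      using distinct_edges_of_path[OF cas dist] set_w by auto
    ultimately have "even (length (filter (\<lambda>(a, d). b a) ((a, True) # w)))"
      by (intro Suc.prems(3)) (simp add: undirected_cycle_def)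
    moreover have "(f ?x \<noteq> f ?y) = odd (length (filter (\<lambda>(a, d). b a) w))"
      by (rule potential_along_walk[OF cas]) (use set_w f H' in auto)
    ultimately have "(f ?y \<noteq> f ?x) = b a" by (auto split: if_splits)
    then show ?thesis using f by blast
  next
    case False
    define C where "C = {z. ?x \<rightarrow>\<^sup>*\<^bsub>both_ways H'\<^esub> z}"
    have C: "tail H e \<in> C \<longleftrightarrow> head H e \<in> C" if "e \<in> arcs H" "e \<noteq> a" for e
    proof -
      have "(e, d) \<in> arcs (both_ways H')" for d using that by (simp add: H')
      note adj = B.in_arcs_imp_in_arcs_ends[OF this]
      from adj[of True] adj[of False] have "tail H e \<rightarrow>\<^bsub>both_ways H'\<^esub> head H e" "head H e \<rightarrow>\<^bsub>both_ways H'\<^esub> tail H e"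
        by (simp_all add: H')
      then show ?thesis unfolding C_def by (auto intro: B.reachable_adj_trans)
    qed
    have xy: "?x \<in> C" "?y \<notin> C" using False ends by (auto simp: C_def H')
    \<comment> \<open>The switch on \<open>C\<close> happens exactly when \<open>f\<close> does not
      fit \<open>a\<close>. Every other edge has both ends on the same side of \<open>C\<close> and
      does not notice it; \<open>a\<close> has only its head in \<open>C\<close>.\<close>
    define g where "g z = ((z \<in> C \<and> (f ?x \<noteq> f ?y) \<noteq> b a) \<noteq> f z)" for z
    have "(g (tail H e) \<noteq> g (head H e)) = b e" if "e \<in> arcs H" for e
      using f[OF that] C[OF that] xy by (cases "e = a") (auto simp: g_def)
    then show ?thesis by blast
  qed
qed

section \<open>Frameworks with half-turn symmetry\<close>

lemma edge_expr_commute: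
  fixes pt :: "'v \<Rightarrow> real^2" and m :: "'v \<Rightarrow> complex^2"
  shows "(\<Sum>i\<in>UNIV. cvec (pt u - pt v) $ i * (m u - m v) $ i)
       = (\<Sum>i\<in>UNIV. cvec (pt v - pt u) $ i * (m v - m u) $ i)"
  unfolding sum_2 by (simp add: algebra_simps)

text \<open>The definite description has a value because exchanging the two ends changes the sign of
  both factors.\<close>

lemma rigidity_map_edge:
  assumes "{u, v} \<in> E"
  shows "rigidity_map E pt m {u, v} =
    of_real (pt u $ 1 - pt v $ 1) * (m u $ 1 - m v $ 1) +
    of_real (pt u $ 2 - pt v $ 2) * (m u $ 2 - m v $ 2)"
proof -
  let ?r = "\<lambda>u v. \<Sum>i\<in>UNIV. cvec (pt u - pt v) $ i * (m u - m v) $ i"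
  have "rigidity_map E pt m {u, v} = (THE x. \<exists>u' v'. {u, v} = {u', v'} \<and> x = ?r u' v')"
    using assms by (simp add: rigidity_map_def)
  also have "\<dots> = ?r u v"
  proof (rule the_equality)
    fix x assume "\<exists>u' v'. {u, v} = {u', v'} \<and> x = ?r u' v'"
    then obtain u' v' where "u = u' \<and> v = v' \<or> u = v' \<and> v = u'" and x: "x = ?r u' v'"
      unfolding doubleton_eq_iff by blast
    then have "?r u' v' = ?r u v" using edge_expr_commute[of pt u v m] by (elim disjE conjE) (simp_all only:)
    then show "x = ?r u v" unfolding x .
  qed blast
  finally show ?thesis by (simp add: sum_2)
qed

lemma mot_sum_nth: "(\<Sum>i\<in>I. mscale (c i) (f i)) v $ j = (\<Sum>i\<in>I. c i * f i v $ j)"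
  by (induction I rule: infinite_finite_induct) (simp_all add: mscale_def)

text \<open>The group is replaced by the involution \<open>\<sigma>\<close> by which its generator
  acts. The half turn is negation, so equivariance becomes \<open>pt_\<sigma>\<close>; the affine
  span supplies \<open>ex_nonzero\<close>, which excludes a framework without vertices off the
  origin.\<close>

locale half_turn_framework =
  fixes V :: "'v set" and E :: "'v set set" and pt :: "'v \<Rightarrow> real^2" and \<sigma> :: "'v \<Rightarrow> 'v"
  assumes simple: "simple_graph V E"
    and \<sigma>_V: "v \<in> V \<Longrightarrow> \<sigma> v \<in> V"
    and \<sigma>_\<sigma>: "v \<in> V \<Longrightarrow> \<sigma> (\<sigma> v) = v"
    and \<sigma>_E: "e \<in> E \<Longrightarrow> \<sigma> ` e \<in> E"
    and inj_pt: "inj_on pt V"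
    and pt_\<sigma>: "v \<in> V \<Longrightarrow> pt (\<sigma> v) = - pt v"
    and ex_nonzero: "\<exists>v\<in>V. pt v \<noteq> 0"
begin

text \<open>
  The parameter \<open>\<kappa>\<close> is \<open>- (- 1) ^ j\<close>: the half turn acts as \<open>- 1\<close> on vectors, hence
  \<open>\<kappa> = - 1\<close> in the fully-symmetric and \<open>\<kappa> = 1\<close> in the anti-symmetric case.
\<close>

definition sym_mot :: "complex \<Rightarrow> ('v \<Rightarrow> complex^2) set" where
  "sym_mot \<kappa> = {m. (\<forall>v. v \<notin> V \<longrightarrow> m v = 0) \<and> (\<forall>v\<in>V. m (\<sigma> v) = \<kappa> *s m v)}"

text \<open>The factor \<open>- \<kappa>\<close> is \<open>(- 1) ^ j\<close>: weights see only the
  character, while motions also receive the sign of the half turn.\<close>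

definition sym_wgt :: "complex \<Rightarrow> ('v set \<Rightarrow> complex) set" where
  "sym_wgt \<kappa> = {w. (\<forall>e. e \<notin> E \<longrightarrow> w e = 0) \<and> (\<forall>e\<in>E. w (\<sigma> ` e) = - \<kappa> * w e)}"

definition row_independent :: "complex \<Rightarrow> bool" where
  "row_independent \<kappa> \<longleftrightarrow> (\<exists>BV BW.
     mot.independent BV \<and> mot.span BV = sym_mot \<kappa> \<and>
     wgt.independent BW \<and> wgt.span BW = sym_wgt \<kappa> \<and>
     no_row_dependence BW BV (block_matrix E pt BW))"

text \<open>\<open>triv None\<close> is the infinitesimal rotation, \<open>triv (Some i)\<close> the translation along axis \<open>i\<close>.\<close>

definition triv :: "2 option \<Rightarrow> 'v \<Rightarrow> complex^2" where
  "triv k v = (if v \<in> V then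
     (case k of None \<Rightarrow> vector [- of_real (pt v $ 2), of_real (pt v $ 1)] | Some i \<Rightarrow> axis i 1)
     else 0)"

section \<open>Edges, fixed vertices, and linearity and symmetry of the rigidity map\<close>

lemma finite_V: "finite V" and finite_E: "finite E" and edge_subset: "e \<in> E \<Longrightarrow> e \<subseteq> V"
  and card_edge: "e \<in> E \<Longrightarrow> card e = 2"
  using simple finite_subset[of E "Pow V"] by (auto simp: simple_graph_def)

lemma edgeE:
  assumes "e \<in> E"
  obtains u v where "e = {u, v}" "u \<in> V" "v \<in> V" "u \<noteq> v"
  using card_edge[OF assms] edge_subset[OF assms] by (auto simp: card_2_iff)

lemma image_\<sigma>_\<sigma>: "e \<in> E \<Longrightarrow> \<sigma> ` \<sigma> ` e = e"
  using edge_subset[of e] \<sigma>_\<sigma> by (force simp: image_image)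

text \<open>By injectivity of \<open>pt\<close> vertices may be compared through their points, and
  only the origin equals its negative. In particular at most one vertex is fixed.\<close>

lemma fixed_iff: "v \<in> V \<Longrightarrow> \<sigma> v = v \<longleftrightarrow> pt v = 0"
proof -
  assume v: "v \<in> V"
  have "\<sigma> v = v \<longleftrightarrow> pt (\<sigma> v) = pt v" using inj_pt \<sigma>_V[OF v] v by (auto dest: inj_onD)
  also have "\<dots> \<longleftrightarrow> pt v = 0" using pt_\<sigma>[OF v] by (simp add: vec_eq_iff)
  finally show ?thesis .
qed

lemma module_hom_rigidity: "module_hom mscale (*) (\<lambda>m. rigidity_map E pt m e)"
proof (cases "e \<in> E")
  case True
  then obtain u v where e: "e = {u, v}" by (elim edgeE)
  have "{u, v} \<in> E" using True e by simp
  then show ?thesis unfolding e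
    by unfold_locales (auto simp: rigidity_map_edge mscale_def algebra_simps)
next
  case False
  then show ?thesis
    by unfold_locales (auto simp: rigidity_map_def mscale_def algebra_simps)
qed

lemmas rigidity_add = module_hom.add[OF module_hom_rigidity]
  and rigidity_sum = module_hom.sum[OF module_hom_rigidity]
  and rigidity_scale = module_hom.scale[OF module_hom_rigidity]

lemma subspace_sym_mot: "mot.subspace (sym_mot \<kappa>)"
  by (rule mot.subspaceI) (auto simp: sym_mot_def mscale_def vec.scale_right_distrib vector_smult_assoc mult.commute)

text \<open>Under the half turn the factor \<open>pt u - pt v\<close> contributes \<open>- 1\<close>
  and the factor \<open>m u - m v\<close> contributes \<open>\<kappa>\<close>.\<close>

lemma rigidity_sym:
  assumes "m \<in> sym_mot \<kappa>"
  shows "rigidity_map E pt m \<in> sym_wgt \<kappa>"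
proof -
  have "rigidity_map E pt m (\<sigma> ` e) = - \<kappa> * rigidity_map E pt m e" if e: "e \<in> E" for e
  proof -
    from e obtain u v where uv: "e = {u, v}" "u \<in> V" "v \<in> V" by (elim edgeE)
    have "{u, v} \<in> E" "{\<sigma> u, \<sigma> v} \<in> E" using e \<sigma>_E[OF e] uv by auto
    then show ?thesis
      using assms uv
      by (simp add: rigidity_map_edge sym_mot_def pt_\<sigma> algebra_simps)
  qed
  then show ?thesis by (auto simp: sym_wgt_def rigidity_map_def)
qed

lemma rigidity_triv: "e \<in> E \<Longrightarrow> rigidity_map E pt (triv k) e = 0"
proof -
  assume e: "e \<in> E"
  then obtain u v where uv: "e = {u, v}" "u \<in> V" "v \<in> V" by (elim edgeE)
  have "{u, v} \<in> E" using e uv by simp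
  then show ?thesis
    using uv by (auto simp: rigidity_map_edge triv_def axis_def algebra_simps split: option.split)
qed

lemma triv_sym:
  shows "triv None \<in> sym_mot (- 1)" and "triv (Some i) \<in> sym_mot 1"
  by (auto simp: sym_mot_def triv_def \<sigma>_V pt_\<sigma> vec_eq_iff forall_2 axis_def)

text \<open>The weights are functions on a whole type, but they vanish outside the finite set
  \<open>E\<close> and so lie in the span of finitely many indicators. Finiteness makes the
  expansion along \<open>BW\<close> in \<open>dual_motions\<close> a genuine finite sum.\<close>

lemma finite_basis_wgt:
  assumes "wgt.independent BW" and "wgt.span BW = sym_wgt \<kappa>"
  shows "finite BW"
proof -
  define \<delta> where "\<delta> e = (\<lambda>x. if x = e then 1 else 0 :: complex)" for e :: "'v set"
  have "BW \<subseteq> wgt.span (\<delta> ` E)"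
  proof
    fix w assume "w \<in> BW"
    then have "w \<in> sym_wgt \<kappa>" using assms(2) wgt.span_base by blast
    then have w0: "w x = 0" if "x \<notin> E" for x using that by (simp add: sym_wgt_def)
    have apply_sum: "(\<Sum>e\<in>F. wscale (w e) (\<delta> e)) x = (\<Sum>e\<in>F. w e * \<delta> e x)" for F x
      by (induction F rule: infinite_finite_induct) (simp_all add: wscale_def)
    have "w = (\<Sum>e\<in>E. wscale (w e) (\<delta> e))"
    proof
      fix x
      have "(\<Sum>e\<in>E. w e * \<delta> e x) = (\<Sum>e\<in>E. if e = x then w e else 0)"
        by (rule sum.cong) (auto simp: \<delta>_def)
      then show "w x = (\<Sum>e\<in>E. wscale (w e) (\<delta> e)) x"
        unfolding apply_sum using finite_E w0[of x] by simp
    qed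
    moreover have "(\<Sum>e\<in>E. wscale (w e) (\<delta> e)) \<in> wgt.span (\<delta> ` E)"
      by (intro wgt.span_sum wgt.span_scale wgt.span_base) auto
    ultimately show "w \<in> wgt.span (\<delta> ` E)" by simp
  qed
  then show ?thesis
    using wgt.independent_span_bound[OF _ assms(1)] finite_E by blast
qed

text \<open>Row independence means that a functional on \<open>sym_wgt \<kappa>\<close> that
  annihilates all rows' images of symmetric motions is zero. Evaluations at one edge per orbit
  (\<open>inj\<close>) are independent, since each orbit supports a symmetric weight; hence they
  stay independent on the image of the rigidity map and have dual motions.\<close>

lemma dual_motions:
  assumes row: "row_independent \<kappa>" and \<kappa>: "\<kappa> \<in> {1, - 1}"
    and nofix: "\<kappa> = 1 \<Longrightarrow> \<forall>e\<in>E. \<sigma> ` e \<noteq> e"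
    and fin: "finite A"
    and ed: "\<And>a. a \<in> A \<Longrightarrow> ed a \<in> E"
    and inj: "\<And>a a'. a \<in> A \<Longrightarrow> a' \<in> A \<Longrightarrow> ed a' \<in> {ed a, \<sigma> ` ed a} \<Longrightarrow> a' = a"
  shows "\<exists>b. \<forall>a\<in>A. b a \<in> sym_mot \<kappa> \<and>
           (\<forall>a'\<in>A. rigidity_map E pt (b a) (ed a') = (if a = a' then 1 else 0))"
proof (rule mot.dual_family_exists[OF fin subspace_sym_mot module_hom_rigidity])
  fix c assume c: "\<And>u. u \<in> sym_mot \<kappa> \<Longrightarrow> (\<Sum>a\<in>A. c a * rigidity_map E pt u (ed a)) = 0"
  from row obtain BV BW where BV: "mot.span BV = sym_mot \<kappa>"
    and BW: "wgt.independent BW" "wgt.span BW = sym_wgt \<kappa>"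
    and nrd: "no_row_dependence BW BV (block_matrix E pt BW)"
    unfolding row_independent_def by blast
  have finBW: "finite BW" by (rule finite_basis_wgt[OF BW])
  \<comment> \<open>A dependence among the chosen edges, read as a functional on weights. Its values
    on \<open>BW\<close> are the coefficients of a row dependence of the block.\<close>
  define L where "L w = (\<Sum>a\<in>A. c a * w (ed a))" for w :: "'v set \<Rightarrow> complex"
  have "module_hom wscale (*) L"
    by unfold_locales (auto simp: L_def wscale_def algebra_simps sum.distrib sum_distrib_left)
  note L = module_hom.sum[OF this] module_hom.scale[OF this]
  have expand: "L w = (\<Sum>x\<in>BW. L x * wgt.representation BW w x)" if "w \<in> sym_wgt \<kappa>" for w
  proof -
    have "w = (\<Sum>x\<in>BW. wscale (wgt.representation BW w x) x)"
      using wgt.sum_representation_eq[OF BW(1) _ finBW] that BW(2) by simp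
    then have "L w = L (\<Sum>x\<in>BW. wscale (wgt.representation BW w x) x)" by simp
    then show ?thesis by (simp only: L mult.commute)
  qed
  have "\<forall>m\<in>BV. (\<Sum>x\<in>BW. L x * block_matrix E pt BW x m) = 0"
  proof
    fix m assume "m \<in> BV"
    then have m: "m \<in> sym_mot \<kappa>" using BV mot.span_base by blast
    have "L (rigidity_map E pt m) = 0" using c[OF m] by (simp add: L_def)
    then show "(\<Sum>x\<in>BW. L x * block_matrix E pt BW x m) = 0"
      using expand[OF rigidity_sym[OF m]] by (simp add: block_matrix_def)
  qed
  then have "\<forall>x\<in>BW. L x = 0" using nrd unfolding no_row_dependence_def by blast
  then have L0: "L w = 0" if "w \<in> sym_wgt \<kappa>" for w using expand[OF that] by simp
  show "\<forall>a\<in>A. c a = 0"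
  proof
    fix a assume a: "a \<in> A"
    \<comment> \<open>The symmetric weight supported on the orbit of \<open>ed a\<close>. If the
      edge is fixed, both prescriptions must agree, which holds for \<open>\<kappa> = - 1\<close>;
      for \<open>\<kappa> = 1\<close> this case is excluded by \<open>nofix\<close>.\<close>
    define w where "w e = (if e = ed a then 1 else if e = \<sigma> ` ed a then - \<kappa> else 0)" for e
    have "w (\<sigma> ` e) = - \<kappa> * w e" if e: "e \<in> E" for e
    proof -
      have "\<sigma> ` e = ed a \<longleftrightarrow> e = \<sigma> ` ed a" "\<sigma> ` e = \<sigma> ` ed a \<longleftrightarrow> e = ed a"
        using image_\<sigma>_\<sigma>[OF e] image_\<sigma>_\<sigma>[OF ed[OF a]] by metis+
      then show ?thesis using \<kappa> nofix ed[OF a] by (auto simp: w_def)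
    qed
    then have "w \<in> sym_wgt \<kappa>" using ed[OF a] \<sigma>_E[OF ed[OF a]] by (auto simp: sym_wgt_def w_def)
    moreover have "L w = (\<Sum>a'\<in>A. if a' = a then c a' else 0)"
      unfolding L_def using inj[OF a] by (intro sum.cong) (auto simp: w_def)
    ultimately show "c a = 0" using L0 a fin by simp
  qed
qed

text \<open>The motions \<open>b a\<close> and \<open>triv k\<close> are independent already on
  \<open>S\<close>: a combination that vanishes on \<open>S\<close> stretches no chosen edge, so
  duality kills the coefficients of the \<open>b a\<close>, and \<open>indep\<close> kills the rest.
  The space \<open>Q\<close> is a parameter because it is the symmetric motions in one use and all
  motions in the balanced case.\<close>

lemma rank_bound:
  assumes fin: "finite A" "finite S" and Q: "mot.subspace Q"
    and ed: "\<And>a. a \<in> A \<Longrightarrow> ed a \<in> E"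
    and b: "\<And>a. a \<in> A \<Longrightarrow> b a \<in> Q" "\<And>k. k \<in> K \<Longrightarrow> triv k \<in> Q"
    and dual: "\<And>a a'. a \<in> A \<Longrightarrow> a' \<in> A \<Longrightarrow>
      rigidity_map E pt (b a) (ed a') = (if a = a' then 1 else 0)"
    and vanish: "\<And>q a. q \<in> Q \<Longrightarrow> (\<forall>v\<in>S. q v = 0) \<Longrightarrow> a \<in> A \<Longrightarrow> rigidity_map E pt q (ed a) = 0"
    and indep: "\<And>d. (\<forall>v\<in>S. \<forall>j. (\<Sum>k\<in>K. d k * triv k v $ j) = 0) \<Longrightarrow> \<forall>k\<in>K. d k = 0"
  shows "card A + card K \<le> 2 * card S"
proof (rule ccontr)
  assume "\<not> ?thesis"
  moreover have finK: "finite K" by simp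
  ultimately have "card (S \<times> (UNIV :: 2 set)) < card (A <+> K)"
    using fin by (simp add: card_cartesian_product card_Plus)
  from underdetermined_system[OF _ this, of "\<lambda>i (v, j). case_sum b triv i v $ j"] fin obtain c
    where c: "\<exists>i\<in>A <+> K. c i \<noteq> 0"
      and c0: "\<And>v j. v \<in> S \<Longrightarrow> (\<Sum>i\<in>A <+> K. c i * case_sum b triv i v $ j) = 0"
    by auto
  have c0': "(\<Sum>a\<in>A. c (Inl a) * b a v $ j) + (\<Sum>k\<in>K. c (Inr k) * triv k v $ j) = 0"
    if "v \<in> S" for v j
    using c0[OF that, of j] fin finK by (simp add: sum.Plus)
  define q where "q = (\<Sum>a\<in>A. mscale (c (Inl a)) (b a)) + (\<Sum>k\<in>K. mscale (c (Inr k)) (triv k))"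
  have "q \<in> Q" unfolding q_def using Q b
    by (intro mot.subspace_add mot.subspace_sum mot.subspace_scale) auto
  moreover have "\<forall>v\<in>S. q v = 0"
    using c0' by (simp add: q_def vec_eq_iff mot_sum_nth)
  ultimately have q0: "rigidity_map E pt q (ed a) = 0" if "a \<in> A" for a
    using vanish that by blast
  have A0: "c (Inl a) = 0" if a: "a \<in> A" for a
  proof -
    have "rigidity_map E pt q (ed a) = (\<Sum>a'\<in>A. c (Inl a') * rigidity_map E pt (b a') (ed a))
        + (\<Sum>k\<in>K. c (Inr k) * rigidity_map E pt (triv k) (ed a))"
      unfolding q_def rigidity_add rigidity_sum rigidity_scale ..
    also have "\<dots> = (\<Sum>a'\<in>A. if a' = a then c (Inl a') else 0)"
      using a dual rigidity_triv[OF ed[OF a]] by (auto intro!: sum.cong)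
    finally show ?thesis using q0[OF a] a fin by simp
  qed
  then have "\<forall>k\<in>K. c (Inr k) = 0" using c0' by (intro indep) auto
  with A0 c show False by auto
qed

section \<open>Independence of the trivial motions at one or two vertices\<close>

lemma indep_rotation:
  assumes "v \<in> V" "pt v \<noteq> 0" "\<forall>j. (\<Sum>k\<in>{None}. d k * triv k v $ j) = 0"
  shows "\<forall>k\<in>{None}. d k = 0"
  using assms by (auto simp: triv_def vec_eq_iff forall_2)

lemma indep_translations:
  assumes "v \<in> V" "\<forall>j. (\<Sum>k\<in>range Some. d k * triv k v $ j) = 0"
  shows "\<forall>k\<in>range Some. d k = 0"
proof -
  have "range Some = {Some 1, Some (2 :: 2)}" by (auto simp: UNIV_2)
  then show ?thesis using assms by (auto simp: triv_def forall_2 axis_def)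
qed

text \<open>With a nonzero rotational coefficient a combination vanishes only at its centre, which
  cannot be at two distinct points; without one it is a translation.\<close>

lemma indep_triv:
  assumes V: "u \<in> V" "v \<in> V" "u \<noteq> v"
    and "\<forall>x\<in>{u, v}. \<forall>j. (\<Sum>k\<in>UNIV. d k * triv k x $ j) = 0"
  shows "\<forall>k\<in>UNIV. d k = 0"
proof -
  have U: "UNIV = {None, Some 1, Some (2 :: 2)}"
    by (auto simp: UNIV_option_conv UNIV_2)
  have eq: "d (Some 1) = d None * of_real (pt x $ 2)" "d (Some 2) = - d None * of_real (pt x $ 1)"
    if "x \<in> {u, v}" for x
    using assms(1,2) assms(4)[rule_format, OF that, of 1] assms(4)[rule_format, OF that, of 2] that
    by (auto simp: U triv_def axis_def add_eq_0_iff algebra_simps)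
  have "pt u \<noteq> pt v" using V inj_pt by (auto dest: inj_onD)
  then have "pt u $ 1 \<noteq> pt v $ 1 \<or> pt u $ 2 \<noteq> pt v $ 2" by (auto simp: vec_eq_iff forall_2)
  then have "d None = 0" using eq[of u] eq[of v] by auto
  then show ?thesis using eq[of u] by (auto simp: U)
qed

text \<open>For \<open>\<kappa> = 1\<close> the motion vanishes at \<open>v\<close> and at
  \<open>\<sigma> v\<close>, whose sum and difference kill translation and rotation. For
  \<open>\<kappa> = - 1\<close> symmetry kills the translation, and one pin is enough: the
  coordinate other than \<open>i\<close> of the rotational velocity at \<open>v\<close> is a
  multiple of \<open>pt v $ i\<close>, which is nonzero.\<close>

lemma trivial_motion_vanishes:
  assumes "trivial_motion V pt m" and m: "m \<in> sym_mot \<kappa>" and \<kappa>: "\<kappa> \<in> {1, - 1}"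
    and v: "v \<in> V" "pt v $ i \<noteq> 0"
    and J: "\<And>j. \<kappa> = 1 \<or> j \<noteq> i \<Longrightarrow> m v $ j = 0"
    and u: "u \<in> V"
  shows "m u = 0"
proof -
  from assms(1) obtain M t where M: "transpose M = - M"
    and mu: "\<And>u. u \<in> V \<Longrightarrow> m u = M *v cvec (pt u) + t"
    unfolding trivial_motion_def by blast
  have skew: "M $ j $ i = - M $ i $ j" for i j
    using arg_cong[OF M, of "\<lambda>A. A $ i $ j"] by (simp add: transpose_def)
  have M': "M $ 1 $ 1 = 0" "M $ 2 $ 2 = 0" "M $ 2 $ 1 = - M $ 1 $ 2"
    using skew[of 1 1] skew[of 2 2] skew[of 2 1] by (simp_all add: complex_eq_iff)
  have c: "m u $ 1 = M $ 1 $ 2 * of_real (pt u $ 2) + t $ 1"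
          "m u $ 2 = - M $ 1 $ 2 * of_real (pt u $ 1) + t $ 2" if "u \<in> V" for u
    using mu[OF that] M' by (simp_all add: matrix_vector_mult_def sum_2)
  have s: "m (\<sigma> v) = \<kappa> *s m v" using m v by (simp add: sym_mot_def)
  then have s': "m (\<sigma> v) $ 1 = \<kappa> * m v $ 1" "m (\<sigma> v) $ 2 = \<kappa> * m v $ 2" by simp_all
  have i: "i = 1 \<or> i = 2" using exhaust_2 by blast
  note cs = c[OF v(1)] c[OF \<sigma>_V[OF v(1)]]
  have "M $ 1 $ 2 = 0 \<and> t $ 1 = 0 \<and> t $ 2 = 0"
  proof (cases "\<kappa> = 1")
    case True
    then have "m v $ 1 = 0" "m v $ 2 = 0" using J by auto
    then show ?thesis using s' cs i v by (auto simp: pt_\<sigma>)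
  next
    case False
    then have "\<kappa> = - 1" using \<kappa> by auto
    then have t: "t $ 1 = 0" "t $ 2 = 0" using s' cs v by (auto simp: pt_\<sigma>)
    then show ?thesis using J[of 1] J[of 2] i cs v by auto
  qed
  then show ?thesis using c[OF u] by (simp add: vec_eq_iff forall_2)
qed

text \<open>Otherwise the \<open>2 * card S\<close> displacements outnumber the edge equations
  together with the pins, and a nonzero symmetric infinitesimal motion satisfies them all. It is
  trivial and pinned, hence zero. The condition on \<open>S\<close> admits one vertex per orbit, and
  a fixed vertex only where symmetric motions can move it.\<close>

lemma motion_bound:
  assumes \<kappa>: "\<kappa> \<in> {1, - 1}"
    and trivial: "\<forall>m\<in>sym_mot \<kappa>. infinitesimal_motion E pt m \<longrightarrow> trivial_motion V pt m"
    and finA: "finite A" and ed: "\<And>a. a \<in> A \<Longrightarrow> ed a \<in> E"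
    and cover: "\<And>e. e \<in> E \<Longrightarrow> \<exists>a\<in>A. e \<in> {ed a, \<sigma> ` ed a}"
    and S: "S \<subseteq> V" "\<And>v. v \<in> S \<Longrightarrow> \<sigma> v \<in> S \<Longrightarrow> \<sigma> v = v \<and> \<kappa> = 1"
  shows "2 * card S \<le> card A + (if \<kappa> = 1 then 2 else 1)"
proof (rule ccontr)
  assume neg: "\<not> ?thesis"
  obtain v0 where v0: "v0 \<in> V" "pt v0 \<noteq> 0" using ex_nonzero by blast
  then obtain i0 where i0: "pt v0 $ i0 \<noteq> 0" by (auto simp: vec_eq_iff)
  \<comment> \<open>The coordinates pinned at \<open>v0\<close>, as many as there are independent
    symmetric trivial motions. The vertex \<open>v0\<close> may lie outside
    \<open>S\<close>.\<close>
  define J where "J = {j. \<kappa> = 1 \<or> j \<noteq> i0}"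
  have "card J = (if \<kappa> = 1 then 2 else 1)"
  proof -
    have "J = (if \<kappa> = 1 then UNIV else UNIV - {i0})" by (auto simp: J_def)
    then show ?thesis by (simp add: card_Diff_singleton)
  qed
  moreover have finS: "finite S" using S(1) finite_V by (rule finite_subset)
  ultimately have card: "card (A <+> J) < card (S \<times> (UNIV :: 2 set))"
    using neg finA by (simp add: card_cartesian_product card_Plus)
  \<comment> \<open>The symmetric motion that displaces \<open>v\<close> along axis \<open>i\<close>
    and moves only the orbit of \<open>v\<close>. At a fixed \<open>v\<close> the first branch wins,
    consistently because \<open>\<kappa> = 1\<close> there.\<close>
  define b :: "'v \<times> 2 \<Rightarrow> 'v \<Rightarrow> complex^2"
    where "b = (\<lambda>(v, i) u. if u = v then axis i 1 else if u = \<sigma> v then \<kappa> *s axis i 1 else 0)"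
  have b_sym: "b x \<in> sym_mot \<kappa>" if x: "x \<in> S \<times> UNIV" for x
  proof -
    obtain v i where vi: "x = (v, i)" "v \<in> S" "v \<in> V" using x S(1) by auto
    have "b x (\<sigma> u) = \<kappa> *s b x u" if u: "u \<in> V" for u
    proof -
      have "\<sigma> u = v \<longleftrightarrow> u = \<sigma> v" "\<sigma> u = \<sigma> v \<longleftrightarrow> u = v"
        using \<sigma>_\<sigma>[OF u] \<sigma>_\<sigma>[OF vi(3)] by metis+
      then show ?thesis using \<kappa> S(2)[OF vi(2)] vi by (auto simp: b_def)
    qed
    moreover have "b x u = 0" if "u \<notin> V" for u
      using that vi(3) \<sigma>_V[OF vi(3)] by (auto simp: b_def vi)
    ultimately show ?thesis by (simp add: sym_mot_def)
  qed
  let ?eq = "\<lambda>x. case_sum (\<lambda>a. rigidity_map E pt (b x) (ed a)) (\<lambda>j. b x v0 $ j)"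
  have "finite (A <+> J)" using finA by simp
  from underdetermined_system[OF this card, of ?eq] obtain c
    where c: "\<exists>x\<in>S \<times> UNIV. c x \<noteq> 0"
      and eq: "\<And>t. t \<in> A <+> J \<Longrightarrow> (\<Sum>x\<in>S \<times> UNIV. c x * ?eq x t) = 0"
    by blast
  define m where "m = (\<Sum>x\<in>S \<times> UNIV. mscale (c x) (b x))"
  have m_sym: "m \<in> sym_mot \<kappa>"
    unfolding m_def using b_sym
    by (intro mot.subspace_sum mot.subspace_scale subspace_sym_mot) auto
  have "rigidity_map E pt m e = 0" if e: "e \<in> E" for e
  proof -
    from cover[OF e] obtain a where a: "a \<in> A" "e \<in> {ed a, \<sigma> ` ed a}" by blast
    have "rigidity_map E pt m (ed a) = 0"
      unfolding m_def rigidity_sum rigidity_scale using eq[OF InlI[OF a(1)]] by simp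
    moreover from this have "rigidity_map E pt m (\<sigma> ` ed a) = 0"
      using rigidity_sym[OF m_sym] ed[OF a(1)] by (simp add: sym_wgt_def)
    ultimately show ?thesis using a(2) by auto
  qed
  then have "trivial_motion V pt m"
    using trivial m_sym by (auto simp: infinitesimal_motion_def)
  moreover have "m v0 $ j = 0" if "\<kappa> = 1 \<or> j \<noteq> i0" for j
  proof -
    have "j \<in> J" using that by (simp add: J_def)
    from eq[OF InrI[OF this]] show ?thesis unfolding m_def mot_sum_nth by simp
  qed
  ultimately have m0: "m u = 0" if "u \<in> V" for u
    using trivial_motion_vanishes[OF _ m_sym \<kappa> v0(1) i0 _ that] by blast
  have "c (v, j) = 0" if v: "v \<in> S" for v j
  proof -
    \<comment> \<open>As \<open>S\<close> meets each orbit at most once, the coordinates of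
      \<open>m\<close> on \<open>S\<close> are the coefficients themselves.\<close>
    have "c x * b x v $ j = (if x = (v, j) then c x else 0)" if x: "x \<in> S \<times> UNIV" for x
    proof -
      obtain w i where x: "x = (w, i)" "w \<in> S" using x by auto
      have "v = \<sigma> w \<Longrightarrow> v = w" using S(2)[OF x(2)] v by auto
      then show ?thesis by (auto simp: x(1) b_def axis_def)
    qed
    then have "m v $ j = (\<Sum>x\<in>S \<times> UNIV. if x = (v, j) then c x else 0)"
      unfolding m_def mot_sum_nth by (rule sum.cong[OF refl])
    also have "\<dots> = c (v, j)" using v finS by simp
    finally show ?thesis using m0[of v] v S(1) by auto
  qed
  with c show False by auto
qed

end

section \<open>Quotients by the half turn\<close>

text \<open>\<open>flip a\<close> says that the gain of the edge \<open>a\<close> is the half turn.\<close>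

locale half_turn_quotient = half_turn_framework V E pt \<sigma>
  for V :: "'v set" and E :: "'v set set" and pt :: "'v \<Rightarrow> real^2" and \<sigma> :: "'v \<Rightarrow> 'v" +
  fixes G :: "('v set, 'v set set) pre_digraph" and rep :: "'v set \<Rightarrow> 'v"
    and flip :: "'v set set \<Rightarrow> bool"
  assumes verts_G: "verts G = (\<lambda>v. {v, \<sigma> v}) ` V"
    and arcs_G: "arcs G = (\<lambda>e. {e, \<sigma> ` e}) ` E"
    and arc_ends: "a \<in> arcs G \<Longrightarrow>
      \<exists>u v. {u, v} \<in> a \<and> tail G a = {u, \<sigma> u} \<and> head G a = {v, \<sigma> v}"
    and rep: "x \<in> verts G \<Longrightarrow> rep x \<in> x"
    and flip: "a \<in> arcs G \<Longrightarrow> \<sigma> (rep (tail G a)) \<noteq> rep (tail G a) \<Longrightarrow>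
      \<sigma> (rep (head G a)) \<noteq> rep (head G a) \<Longrightarrow>
      {rep (tail G a), if flip a then \<sigma> (rep (head G a)) else rep (head G a)} \<in> a"
begin

section \<open>Orbits, representatives and edge counts in the quotient\<close>

lemma finite_verts: "finite (verts G)" and finite_arcs: "finite (arcs G)"
  by (simp_all add: verts_G arcs_G finite_V finite_E)

lemma mem_arc:
  assumes "a \<in> arcs G" and "e \<in> a"
  shows "e \<in> E" and "a = {e, \<sigma> ` e}"
proof -
  obtain e0 where "e0 \<in> E" "a = {e0, \<sigma> ` e0}" using assms(1) by (auto simp: arcs_G)
  then have "e = e0 \<and> e \<in> E \<or> e = \<sigma> ` e0 \<and> e \<in> E \<and> \<sigma> ` e = e0" "a = {e0, \<sigma> ` e0}"
    using assms(2) \<sigma>_E[of e0] image_\<sigma>_\<sigma>[of e0] by (metis insertE singletonD)+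
  then show "e \<in> E" "a = {e, \<sigma> ` e}" by (metis insert_commute)+
qed

lemma vert_eq:
  assumes "x \<in> verts G"
  shows "rep x \<in> V" and "x = {rep x, \<sigma> (rep x)}"
proof -
  obtain v where "v \<in> V" "x = {v, \<sigma> v}" using assms by (auto simp: verts_G)
  then show "rep x \<in> V" "x = {rep x, \<sigma> (rep x)}" using rep[OF assms] \<sigma>_V \<sigma>_\<sigma> by auto
qed

lemma mem_vert: "x \<in> verts G \<Longrightarrow> u \<in> x \<Longrightarrow> u = rep x \<or> u = \<sigma> (rep x)"
  using vert_eq(2) by blast

lemma inj_rep: "inj_on rep (verts G)"
  by (rule inj_onI) (metis vert_eq(2))

text \<open>The assumption \<open>arc_ends\<close> speaks of one edge of the orbit; the half turn
  carries it to the other.\<close>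

lemma edge_ends:
  assumes "a \<in> arcs G" and "e \<in> a"
  shows "\<exists>u v. e = {u, v} \<and> u \<noteq> v \<and> u \<in> V \<and> v \<in> V \<and> u \<in> tail G a \<and> v \<in> head G a"
proof -
  from arc_ends[OF assms(1)] obtain u v
    where uv: "{u, v} \<in> a" "tail G a = {u, \<sigma> u}" "head G a = {v, \<sigma> v}" by blast
  note E = mem_arc(1)[OF assms(1)]
  have V: "u \<in> V" "v \<in> V" using edge_subset[OF E[OF uv(1)]] by auto
  have "e = {u, v} \<or> e = {\<sigma> u, \<sigma> v}" using mem_arc(2)[OF assms(1) uv(1)] assms(2) by auto
  then obtain u' v' where e: "e = {u', v'}" "u' \<in> V" "v' \<in> V" "u' \<in> tail G a" "v' \<in> head G a"
    using uv V \<sigma>_V by auto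
  moreover have "u' \<noteq> v'" using card_edge[OF E[OF assms(2)]] e(1) by auto
  ultimately show ?thesis by blast
qed

lemma subgraph_arc:
  assumes "subgraph H G" and "a \<in> arcs H"
  shows "a \<in> arcs G" "tail G a \<in> verts H" "head G a \<in> verts H"
  using assms by (auto simp: subgraph_def compatible_def wf_digraph_def)

text \<open>The two ends of an edge lie at distinct points, so they are not both at the
  origin.\<close>

lemma ex_free_vertex:
  assumes H: "subgraph H G" and "arcs H \<noteq> {}"
  shows "\<exists>x\<in>verts H. \<sigma> (rep x) \<noteq> rep x"
proof -
  obtain a where a: "a \<in> arcs H" using assms(2) by blast
  note a' = subgraph_arc[OF H a]
  then obtain e where "e \<in> a" by (auto simp: arcs_G)
  from edge_ends[OF a'(1) this] obtain u v where uv: "u \<noteq> v" "u \<in> V" "v \<in> V"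
    "u \<in> tail G a" "v \<in> head G a" by blast
  have "pt u \<noteq> pt v" using inj_pt uv by (auto dest: inj_onD)
  then have "\<sigma> u \<noteq> u \<or> \<sigma> v \<noteq> v" using uv fixed_iff by auto
  then obtain w x where w: "w \<in> x" "x \<in> verts H" "\<sigma> w \<noteq> w" using uv a' by blast
  have "x \<in> verts G" using w(2) H by auto
  with mem_vert[OF this w(1)] w(3) have "\<sigma> (rep x) \<noteq> rep x" by auto
  with w(2) show ?thesis by blast
qed

lemma dual_motions_arcs:
  assumes "row_independent \<kappa>" and "\<kappa> \<in> {1, - 1}"
    and "\<kappa> = 1 \<Longrightarrow> \<forall>e\<in>E. \<sigma> ` e \<noteq> e"
    and A: "A \<subseteq> arcs G" and ed: "\<And>a. a \<in> A \<Longrightarrow> ed a \<in> a"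
  shows "\<exists>b. \<forall>a\<in>A. b a \<in> sym_mot \<kappa> \<and>
           (\<forall>a'\<in>A. rigidity_map E pt (b a) (ed a') = (if a = a' then 1 else 0))"
proof (rule dual_motions[OF assms(1-3)])
  show "finite A" using A finite_arcs by (rule finite_subset)
  show "ed a \<in> E" if "a \<in> A" for a using mem_arc(1)[OF _ ed[OF that]] A that by blast
  fix a a' assume a: "a \<in> A" "a' \<in> A" and "ed a' \<in> {ed a, \<sigma> ` ed a}"
  then have "ed a' \<in> a" using mem_arc(2)[OF _ ed[OF a(1)]] A by blast
  then show "a' = a" using mem_arc(2)[of a "ed a'"] mem_arc(2)[OF _ ed[OF a(2)]] a A by auto
qed

text \<open>The set \<open>Y\<close> consists of the vertices where symmetric motions can be
  nonzero: for \<open>\<kappa> = - 1\<close> they vanish at fixed vertices. By symmetry, vanishing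
  at the representatives in \<open>Y\<close> means vanishing on all orbits of \<open>H\<close>, so
  no edge over \<open>H\<close> is stretched and \<open>rank_bound\<close> applies.\<close>

lemma subgraph_bound:
  assumes row: "row_independent \<kappa>" and \<kappa>: "\<kappa> \<in> {1, - 1}"
    and nofix: "\<kappa> = 1 \<Longrightarrow> \<forall>e\<in>E. \<sigma> ` e \<noteq> e"
    and H: "subgraph H G" and Y: "Y = {x \<in> verts H. \<kappa> = 1 \<or> \<sigma> (rep x) \<noteq> rep x}"
    and K: "\<And>k. k \<in> K \<Longrightarrow> triv k \<in> sym_mot \<kappa>"
    and indep: "\<And>d. (\<forall>x\<in>Y. \<forall>j. (\<Sum>k\<in>K. d k * triv k (rep x) $ j) = 0) \<Longrightarrow> \<forall>k\<in>K. d k = 0"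
  shows "card (arcs H) + card K \<le> 2 * card Y"
proof -
  have sub: "verts H \<subseteq> verts G" "arcs H \<subseteq> arcs G" using H by auto
  have YG: "Y \<subseteq> verts G" using sub Y by auto
  define ed where "ed a = (SOME e. e \<in> a)" for a :: "'v set set"
  have ed: "ed a \<in> a" if "a \<in> arcs H" for a
  proof -
    have "\<exists>e. e \<in> a" using that sub by (auto simp: arcs_G)
    then show ?thesis unfolding ed_def by (rule someI_ex)
  qed
  from dual_motions_arcs[OF row \<kappa> nofix sub(2) ed] obtain b
    where b: "\<And>a. a \<in> arcs H \<Longrightarrow> b a \<in> sym_mot \<kappa>"
      "\<And>a a'. a \<in> arcs H \<Longrightarrow> a' \<in> arcs H \<Longrightarrow>
         rigidity_map E pt (b a) (ed a') = (if a = a' then 1 else 0)" by blast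
  have "card (arcs H) + card K \<le> 2 * card (rep ` Y)"
  proof (rule rank_bound[OF _ _ subspace_sym_mot _ b(1) K b(2)])
    show "finite (arcs H)" "finite (rep ` Y)"
      using sub YG finite_arcs finite_verts by (auto intro: finite_subset)
    show "ed a \<in> E" if "a \<in> arcs H" for a using mem_arc(1)[OF _ ed[OF that]] sub that by blast
    show "\<forall>k\<in>K. d k = 0" if "\<forall>v\<in>rep ` Y. \<forall>j. (\<Sum>k\<in>K. d k * triv k v $ j) = 0" for d
      using that by (intro indep) simp
    fix q a assume q: "q \<in> sym_mot \<kappa>" "\<forall>v\<in>rep ` Y. q v = 0" and a: "a \<in> arcs H"
    have q0: "q u = 0" if x: "x \<in> verts H" "u \<in> x" for x u
    proof -
      have xG: "x \<in> verts G" using x sub by auto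
      have s: "q (\<sigma> (rep x)) = \<kappa> *s q (rep x)" using q(1) vert_eq(1)[OF xG] by (simp add: sym_mot_def)
      have "q (rep x) = 0"
      proof (cases "x \<in> Y")
        case True
        then show ?thesis using q(2) by simp
      next
        case False
        then have "\<kappa> = - 1" "\<sigma> (rep x) = rep x" using x \<kappa> Y by auto
        then show ?thesis using s by (simp add: vec_eq_iff complex_eq_iff)
      qed
      then show ?thesis using mem_vert[OF xG x(2)] s by auto
    qed
    note a' = subgraph_arc[OF H a]
    from edge_ends[OF a'(1) ed[OF a]] obtain u v
      where uv: "ed a = {u, v}" "u \<in> tail G a" "v \<in> head G a" by blast
    have "{u, v} \<in> E" using mem_arc(1)[OF a'(1) ed[OF a]] uv by simp
    then show "rigidity_map E pt q (ed a) = 0"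
      using q0[OF a'(2) uv(2)] q0[OF a'(3) uv(3)] by (simp add: uv(1) rigidity_map_edge)
  qed auto
  then show ?thesis using card_image[OF inj_on_subset[OF inj_rep YG]] by simp
qed

text \<open>
  A potential \<open>f\<close> switches the representatives so that all edges of \<open>H\<close> lift to the new
  representatives; motions of the lifted copy of \<open>H\<close> are not subject to any symmetry.
\<close>

lemma balanced_subgraph_bound:
  fixes f :: "'v set \<Rightarrow> bool"
  assumes row: "row_independent \<kappa>" and \<kappa>: "\<kappa> \<in> {1, - 1}"
    and nofix: "\<kappa> = 1 \<Longrightarrow> \<forall>e\<in>E. \<sigma> ` e \<noteq> e"
    and H: "subgraph H G" and ne: "arcs H \<noteq> {}"
    and f: "\<And>a. a \<in> arcs H \<Longrightarrow> \<sigma> (rep (tail G a)) \<noteq> rep (tail G a) \<Longrightarrow>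
      \<sigma> (rep (head G a)) \<noteq> rep (head G a) \<Longrightarrow> (f (tail G a) \<noteq> f (head G a)) = flip a"
  shows "card (arcs H) + 3 \<le> 2 * card (verts H)"
proof -
  have sub: "verts H \<subseteq> verts G" "arcs H \<subseteq> arcs G" using H by auto
  define s where "s x = (if f x then \<sigma> (rep x) else rep x)" for x
  have s: "s x \<in> V" "x = {s x, \<sigma> (s x)}" if "x \<in> verts G" for x
    using vert_eq[OF that] \<sigma>_V \<sigma>_\<sigma> by (auto simp: s_def)
  have inj: "inj_on s (verts H)"
    using sub(1) by (intro inj_onI) (metis s(2) subsetD)
  define ed where "ed a = {s (tail G a), s (head G a)}" for a
  have ed: "ed a \<in> a" if aH: "a \<in> arcs H" for a
  proof -
    note a = subgraph_arc[OF H aH]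
    let ?t = "tail G a" and ?h = "head G a"
    have V: "?t \<in> verts G" "?h \<in> verts G" using a sub by auto
    have closed: "\<sigma> ` e \<in> a" if "e \<in> a" for e using mem_arc(2)[OF a(1) that] by blast
    show ?thesis
    proof (cases "\<sigma> (rep ?t) \<noteq> rep ?t \<and> \<sigma> (rep ?h) \<noteq> rep ?h")
      case True
      note e = flip[OF a(1)] closed[OF flip[OF a(1)]] and f = f[OF aH]
      show ?thesis
        using True e f vert_eq(1)[OF V(1)] vert_eq(1)[OF V(2)] \<sigma>_\<sigma>
        by (auto simp: ed_def s_def split: if_splits)
    next
      case False
      obtain e where "e \<in> a" using a by (auto simp: arcs_G)
      from edge_ends[OF a(1) this] obtain u v
        where e: "{u, v} \<in> a" and uv: "u \<in> ?t" "v \<in> ?h" "u \<in> V" "v \<in> V" using \<open>e \<in> a\<close> by blast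
      have e': "{\<sigma> u, \<sigma> v} \<in> a" using closed[OF e] by simp
      have "u = s ?t \<or> \<sigma> u = s ?t" "v = s ?h \<or> \<sigma> v = s ?h"
        using s[OF V(1)] s[OF V(2)] uv \<sigma>_\<sigma> by auto
      \<comment> \<open>The half turn of the edge then changes only the other end, so the orbit
        contains the lift for either choice of representative, whatever the gain.\<close>
      moreover have "\<sigma> u = u \<or> \<sigma> v = v"
        using False mem_vert[OF V(1) uv(1)] mem_vert[OF V(2) uv(2)] by auto
      ultimately show ?thesis using e e' unfolding ed_def by metis
    qed
  qed
  from dual_motions_arcs[OF row \<kappa> nofix sub(2) ed] obtain b
    where b: "\<And>a a'. a \<in> arcs H \<Longrightarrow> a' \<in> arcs H \<Longrightarrow>
         rigidity_map E pt (b a) (ed a') = (if a = a' then 1 else 0)" by blast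
  have edE: "ed a \<in> E" if "a \<in> arcs H" for a using mem_arc(1)[OF _ ed[OF that]] sub that by blast
  have "card (arcs H) + card (UNIV :: 2 option set) \<le> 2 * card (s ` verts H)"
  proof (rule rank_bound[OF _ _ mot.subspace_UNIV edE _ _ b])
    show "finite (arcs H)" "finite (s ` verts H)"
      using sub finite_arcs finite_verts by (auto intro: finite_subset)
    obtain a where a: "a \<in> arcs H" using ne by blast
    have uv: "s (tail G a) \<in> V" "s (head G a) \<in> V" "s (tail G a) \<noteq> s (head G a)"
      using edge_subset[OF edE[OF a]] card_edge[OF edE[OF a]] by (auto simp: ed_def)
    show "\<forall>k\<in>UNIV. d k = 0" if "\<forall>v\<in>s ` verts H. \<forall>j. (\<Sum>k\<in>UNIV. d k * triv k v $ j) = 0" for d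
      using that subgraph_arc[OF H a] by (intro indep_triv[OF uv]) auto
    show "rigidity_map E pt q (ed a) = 0" if q: "\<forall>v\<in>s ` verts H. q v = 0" and a: "a \<in> arcs H" for q a
    proof -
      have "q (s (tail G a)) = 0" "q (s (head G a)) = 0" using q subgraph_arc[OF H a] by auto
      then show ?thesis using edE[OF a] unfolding ed_def by (simp add: rigidity_map_edge)
    qed
  qed auto
  then show ?thesis using card_image[OF inj] by (simp add: card_UNIV_option)
qed

text \<open>The set \<open>Y\<close> is the one of \<open>subgraph_bound\<close> for
  \<open>G\<close> itself, so that the two counts meet in an equality.\<close>

lemma arcs_lower_bound:
  assumes \<kappa>: "\<kappa> \<in> {1, - 1}"
    and trivial: "\<forall>m\<in>sym_mot \<kappa>. infinitesimal_motion E pt m \<longrightarrow> trivial_motion V pt m"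
    and Y: "Y = {x \<in> verts G. \<kappa> = 1 \<or> \<sigma> (rep x) \<noteq> rep x}"
  shows "2 * card Y \<le> card (arcs G) + (if \<kappa> = 1 then 2 else 1)"
proof -
  define ed where "ed a = (SOME e. e \<in> a)" for a :: "'v set set"
  have ed: "ed a \<in> a" if "a \<in> arcs G" for a
  proof -
    have "\<exists>e. e \<in> a" using that by (auto simp: arcs_G)
    then show ?thesis unfolding ed_def by (rule someI_ex)
  qed
  have "2 * card (rep ` Y) \<le> card (arcs G) + (if \<kappa> = 1 then 2 else 1)"
  proof (rule motion_bound[OF \<kappa> trivial finite_arcs])
    show "ed a \<in> E" if "a \<in> arcs G" for a using mem_arc(1)[OF that ed[OF that]] .
    show "\<exists>a\<in>arcs G. e \<in> {ed a, \<sigma> ` ed a}" if "e \<in> E" for e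
    proof -
      have a: "{e, \<sigma> ` e} \<in> arcs G" using that by (auto simp: arcs_G)
      have "e \<in> {e, \<sigma> ` e}" by simp
      then show ?thesis using mem_arc(2)[OF a ed[OF a]] a by blast
    qed
    show "rep ` Y \<subseteq> V" using vert_eq(1) by (auto simp: Y)
    fix v assume "v \<in> rep ` Y" "\<sigma> v \<in> rep ` Y"
    then obtain x y where xy: "x \<in> Y" "y \<in> Y" "v = rep x" "\<sigma> v = rep y" by auto
    then have V: "x \<in> verts G" "y \<in> verts G" by (auto simp: Y)
    have "\<sigma> (rep y) = rep x" using \<sigma>_\<sigma>[OF vert_eq(1)[OF V(1)]] xy by simp
    then have "x = y"
      using vert_eq(2)[OF V(1)] vert_eq(2)[OF V(2)] xy by (metis insert_commute)
    then show "\<sigma> v = v \<and> \<kappa> = 1" using xy by (auto simp: Y)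
  qed
  moreover have "card (rep ` Y) = card Y"
    by (rule card_image[OF inj_on_subset[OF inj_rep]]) (auto simp: Y)
  ultimately show ?thesis by simp
qed

lemma wf_G: "wf_digraph G"
proof
  fix a assume a: "a \<in> arcs G"
  from arc_ends[OF a] obtain u v
    where uv: "{u, v} \<in> a" "tail G a = {u, \<sigma> u}" "head G a = {v, \<sigma> v}" by blast
  have "u \<in> V" "v \<in> V" using edge_subset[OF mem_arc(1)[OF a uv(1)]] by auto
  then show "tail G a \<in> verts G" "head G a \<in> verts G" using uv by (auto simp: verts_G)
qed

text \<open>The equality for \<open>G\<close> must hold also when \<open>G\<close> has no arcs,
  where \<open>ex_free_vertex\<close> gives nothing; a vertex off the origin is used
  instead.\<close>

lemma ex_free_vertex_G: "\<exists>x\<in>verts G. \<sigma> (rep x) \<noteq> rep x"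
proof -
  obtain v where v: "v \<in> V" "pt v \<noteq> 0" using ex_nonzero by blast
  then have x: "{v, \<sigma> v} \<in> verts G" by (simp add: verts_G)
  have "\<sigma> v \<noteq> v" using v fixed_iff by simp
  with mem_vert[OF x, of v] have "\<sigma> (rep {v, \<sigma> v}) \<noteq> rep {v, \<sigma> v}" by auto
  then show ?thesis using x by blast
qed

text \<open>The rotation vanishes at the origin, so a free vertex is required to detect it; for
  translations any vertex will do.\<close>

lemma subgraph_bound_rotation:
  assumes "row_independent (- 1)" and H: "subgraph H G"
    and "\<exists>x\<in>verts H. \<sigma> (rep x) \<noteq> rep x"
  shows "card (arcs H) + 1 \<le> 2 * card {x \<in> verts H. \<sigma> (rep x) \<noteq> rep x}"
proof -
  obtain x where x: "x \<in> verts H" "\<sigma> (rep x) \<noteq> rep x" using assms(3) by blast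
  then have xV: "rep x \<in> V" using H vert_eq(1) by auto
  then have "pt (rep x) \<noteq> 0" using x fixed_iff by auto
  then have "\<forall>k\<in>{None}. d k = 0"
    if "\<forall>x\<in>{x \<in> verts H. \<sigma> (rep x) \<noteq> rep x}. \<forall>j. (\<Sum>k\<in>{None}. d k * triv k (rep x) $ j) = 0" for d
    using that x by (intro indep_rotation[OF xV]) auto
  then show ?thesis
    using subgraph_bound[OF assms(1) _ _ H, where K = "{None}"] triv_sym(1) by auto
qed

lemma subgraph_bound_translations:
  assumes "row_independent 1" and "\<forall>e\<in>E. \<sigma> ` e \<noteq> e" and H: "subgraph H G"
    and "verts H \<noteq> {}"
  shows "card (arcs H) + 2 \<le> 2 * card (verts H)"
proof -
  obtain x where x: "x \<in> verts H" using assms(4) by blast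
  then have xV: "rep x \<in> V" using H vert_eq(1) by auto
  have "\<forall>k\<in>range Some. d k = 0"
    if "\<forall>x\<in>verts H. \<forall>j. (\<Sum>k\<in>range Some. d k * triv k (rep x) $ j) = 0" for d
    using that x by (intro indep_translations[OF xV]) auto
  moreover have "card (range (Some :: 2 \<Rightarrow> 2 option)) = 2" by (simp add: card_image)
  ultimately show ?thesis
    using subgraph_bound[OF assms(1) _ _ H, where K = "range Some" and Y = "verts H"]
      triv_sym(2) assms(2) by auto
qed

end

section \<open>Gain graphs over a group of order two\<close>

lemma order_two_group:
  fixes \<Gamma> :: "'g monoid"
  assumes "group \<Gamma>" and "order \<Gamma> = 2"
  obtains \<gamma> where "carrier \<Gamma> = {\<one>\<^bsub>\<Gamma>\<^esub>, \<gamma>}" "\<gamma> \<noteq> \<one>\<^bsub>\<Gamma>\<^esub>" "\<gamma> \<otimes>\<^bsub>\<Gamma>\<^esub> \<gamma> = \<one>\<^bsub>\<Gamma>\<^esub>"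
proof -
  interpret group \<Gamma> by fact
  have "card (carrier \<Gamma>) = 2" using assms(2) by (simp add: order_def)
  then obtain x y where xy: "carrier \<Gamma> = {x, y}" "x \<noteq> y" by (auto simp: card_2_iff)
  define \<gamma> where "\<gamma> = (if x = \<one>\<^bsub>\<Gamma>\<^esub> then y else x)"
  have \<gamma>: "carrier \<Gamma> = {\<one>\<^bsub>\<Gamma>\<^esub>, \<gamma>}" "\<gamma> \<noteq> \<one>\<^bsub>\<Gamma>\<^esub>"
    using xy one_closed by (auto simp: \<gamma>_def)
  have "\<gamma> \<in> carrier \<Gamma>" using \<gamma>(1) by blast
  then have "\<gamma> \<otimes>\<^bsub>\<Gamma>\<^esub> \<gamma> \<in> {\<one>\<^bsub>\<Gamma>\<^esub>, \<gamma>}" "\<gamma> \<otimes>\<^bsub>\<Gamma>\<^esub> \<gamma> \<noteq> \<gamma>"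
    using m_closed[of \<gamma> \<gamma>] l_cancel_one[of \<gamma> \<gamma>] \<gamma> by auto
  then show thesis using that \<gamma> by blast
qed

text \<open>Every element is its own inverse, so orientation is irrelevant and gains add up as
  parities. This brings balance into the form required by \<open>potential_exists\<close>.\<close>

lemma walk_gain_order_two:
  fixes \<Gamma> :: "'g monoid"
  assumes "group \<Gamma>" and "order \<Gamma> = 2" and "\<psi> ` fst ` set w \<subseteq> carrier \<Gamma>"
  shows "walk_gain \<Gamma> \<psi> w = \<one>\<^bsub>\<Gamma>\<^esub> \<longleftrightarrow> even (length (filter (\<lambda>(a, d). \<psi> a \<noteq> \<one>\<^bsub>\<Gamma>\<^esub>) w))"
proof -
  interpret group \<Gamma> by fact
  obtain \<gamma> where \<gamma>: "carrier \<Gamma> = {\<one>\<^bsub>\<Gamma>\<^esub>, \<gamma>}" "\<gamma> \<noteq> \<one>\<^bsub>\<Gamma>\<^esub>" "\<gamma> \<otimes>\<^bsub>\<Gamma>\<^esub> \<gamma> = \<one>\<^bsub>\<Gamma>\<^esub>"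
    by (rule order_two_group[OF assms(1,2)])
  have \<gamma>_in: "\<gamma> \<in> carrier \<Gamma>" using \<gamma>(1) by blast
  have inv: "inv\<^bsub>\<Gamma>\<^esub> x = x" if "x \<in> carrier \<Gamma>" for x
    using that \<gamma> inv_equality[OF \<gamma>(3) \<gamma>_in \<gamma>_in] by auto
  have "walk_gain \<Gamma> \<psi> w =
    (if even (length (filter (\<lambda>(a, d). \<psi> a \<noteq> \<one>\<^bsub>\<Gamma>\<^esub>) w)) then \<one>\<^bsub>\<Gamma>\<^esub> else \<gamma>)"
    using assms(3)
  proof (induction w)
    case Nil
    then show ?case by simp
  next
    case (Cons x w)
    obtain a d where x: "x = (a, d)" by (cases x)
    have "\<psi> a \<in> carrier \<Gamma>" using Cons.prems x by auto
    then have "walk_gain \<Gamma> \<psi> (x # w) = \<psi> a \<otimes>\<^bsub>\<Gamma>\<^esub> walk_gain \<Gamma> \<psi> w" "\<psi> a \<in> {\<one>\<^bsub>\<Gamma>\<^esub>, \<gamma>}"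
      using inv \<gamma>(1) by (auto simp: x)
    then show ?case using Cons \<gamma> \<gamma>_in by (auto simp: x)
  qed
  then show ?thesis using \<gamma> by auto
qed

section \<open>From the group action to the half turn\<close>

lemma C2_matrices_eq: "C2_matrices = {mat 1, - mat 1}"
proof -
  have "vector [vector [cos pi, - sin pi], vector [sin pi, cos pi]] = (- mat 1 :: real^2^2)"
    by (simp add: vec_eq_iff forall_2 mat_def)
  then show ?thesis unfolding C2_matrices_def by simp
qed

lemma orbit_two: "carrier \<Gamma> = {g, h} \<Longrightarrow> orbit \<Gamma> f x = {f g x, f h x}"
  by (force simp: orbit_def)

lemma mat_square_minus_one: "(- mat 1 :: real^2^2) ** - mat 1 = mat 1"
  by (simp add: vec_eq_iff forall_2 mat_def matrix_matrix_mult_def sum_2)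

lemma cmat_minus_one: "cmat (- mat 1) *v x = - x"
  by (simp add: vec_eq_iff forall_2 mat_def matrix_vector_mult_def sum_2 map_matrix_def)

lemma cmat_one: "cmat (mat 1) *v x = x"
  by (simp add: vec_eq_iff forall_2 mat_def matrix_vector_mult_def sum_2 map_matrix_def)

lemma half_turn_quotient_of_gain_framework:
  fixes \<Gamma> :: "'g monoid" and \<phi> :: "'g \<Rightarrow> 'v \<Rightarrow> 'v"
  assumes "group \<Gamma>" and "order \<Gamma> = 2"
    and fw: "C2_symmetric_framework \<Gamma> \<phi> \<tau> V E pt"
    and gf: "gain_framework \<Gamma> \<phi> V E pt G rep \<psi> p"
    and \<gamma>: "carrier \<Gamma> = {\<one>\<^bsub>\<Gamma>\<^esub>, \<gamma>}" "\<gamma> \<noteq> \<one>\<^bsub>\<Gamma>\<^esub>" "\<gamma> \<otimes>\<^bsub>\<Gamma>\<^esub> \<gamma> = \<one>\<^bsub>\<Gamma>\<^esub>"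
  shows "half_turn_quotient V E pt (\<phi> \<gamma>) G rep (\<lambda>a. \<psi> a \<noteq> \<one>\<^bsub>\<Gamma>\<^esub>)"
    and "\<tau> \<gamma> = - mat 1" and "\<And>v. v \<in> V \<Longrightarrow> \<phi> \<one>\<^bsub>\<Gamma>\<^esub> v = v" and "\<tau> \<one>\<^bsub>\<Gamma>\<^esub> = mat 1"
proof -
  interpret group \<Gamma> by fact
  have \<gamma>_in: "\<gamma> \<in> carrier \<Gamma>" using \<gamma>(1) by blast
  have fw': "simple_graph V E" "group_action \<Gamma> V \<phi>"
    "\<forall>g\<in>carrier \<Gamma>. \<forall>e\<in>E. edge_action \<phi> g e \<in> E"
    "\<forall>g\<in>carrier \<Gamma>. \<forall>h\<in>carrier \<Gamma>. \<tau> (g \<otimes>\<^bsub>\<Gamma>\<^esub> h) = \<tau> g ** \<tau> h"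
    "inj_on \<tau> (carrier \<Gamma>)" "\<tau> ` carrier \<Gamma> = C2_matrices"
    "inj_on pt V" "affine hull (pt ` V) = UNIV"
    "\<forall>g\<in>carrier \<Gamma>. \<forall>v\<in>V. \<tau> g *v pt v = pt (\<phi> g v)"
    using fw by (simp_all add: C2_symmetric_framework_def)
  interpret group_action \<Gamma> V \<phi> by fact
  show id: "\<phi> \<one>\<^bsub>\<Gamma>\<^esub> v = v" if "v \<in> V" for v
    using that by (simp add: id_eq_one[symmetric])
  have img: "{\<tau> \<one>\<^bsub>\<Gamma>\<^esub>, \<tau> \<gamma>} = {mat 1, - mat 1}"
    using fw'(6) by (simp add: \<gamma>(1) C2_matrices_eq)
  have ne: "\<tau> \<one>\<^bsub>\<Gamma>\<^esub> \<noteq> \<tau> \<gamma>" using fw'(5) \<gamma>(2) \<gamma>_in by (auto dest: inj_onD)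
  \<comment> \<open>Of the two matrices only \<open>mat 1\<close> is idempotent.\<close>
  have "\<tau> \<one>\<^bsub>\<Gamma>\<^esub> ** \<tau> \<one>\<^bsub>\<Gamma>\<^esub> = \<tau> \<one>\<^bsub>\<Gamma>\<^esub>" using fw'(4) one_closed by (metis r_one)
  then have "\<tau> \<one>\<^bsub>\<Gamma>\<^esub> = mat 1"
    using img mat_square_minus_one by (metis insert_iff singletonD)
  then show \<tau>: "\<tau> \<one>\<^bsub>\<Gamma>\<^esub> = mat 1" "\<tau> \<gamma> = - mat 1" using img ne by (auto simp: doubleton_eq_iff)
  have orb: "orbit \<Gamma> \<phi> v = {v, \<phi> \<gamma> v}" if "v \<in> V" for v
    using id[OF that] by (simp add: orbit_two[OF \<gamma>(1)])
  have E: "e \<subseteq> V" if "e \<in> E" for e using fw'(1) that by (simp add: simple_graph_def)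
  have orbE: "orbit \<Gamma> (edge_action \<phi>) e = {e, \<phi> \<gamma> ` e}" if "e \<in> E" for e
  proof -
    have "\<phi> \<one>\<^bsub>\<Gamma>\<^esub> ` e = e" using id E[OF that] by (force simp: image_iff)
    then show ?thesis by (simp add: orbit_two[OF \<gamma>(1)] edge_action_def)
  qed
  have free: "free_vertex \<Gamma> \<phi> v \<longleftrightarrow> \<phi> \<gamma> v \<noteq> v" if "v \<in> V" for v
    using id[OF that] \<gamma> by (auto simp: free_vertex_def stabilizer_def)
  have gf': "verts G = orbits \<Gamma> V \<phi>" "arcs G = orbits \<Gamma> E (edge_action \<phi>)"
    "\<And>a. a \<in> arcs G \<Longrightarrow>
       \<exists>u v. {u, v} \<in> a \<and> tail G a = orbit \<Gamma> \<phi> u \<and> head G a = orbit \<Gamma> \<phi> v"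
    "\<And>x. x \<in> verts G \<Longrightarrow> rep x \<in> x"
    "\<And>a. a \<in> arcs G \<Longrightarrow> \<psi> a \<in> carrier \<Gamma>"
    "\<And>a. a \<in> arcs G \<Longrightarrow> free_vertex \<Gamma> \<phi> (rep (tail G a)) \<Longrightarrow>
       free_vertex \<Gamma> \<phi> (rep (head G a)) \<Longrightarrow> {rep (tail G a), \<phi> (\<psi> a) (rep (head G a))} \<in> a"
    using gf by (simp_all add: gain_framework_def)
  show "half_turn_quotient V E pt (\<phi> \<gamma>) G rep (\<lambda>a. \<psi> a \<noteq> \<one>\<^bsub>\<Gamma>\<^esub>)"
  proof
    show "simple_graph V E" "inj_on pt V" by fact+
    show V: "\<phi> \<gamma> v \<in> V" if "v \<in> V" for v using element_image[OF \<gamma>_in that] by simp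
    show "\<phi> \<gamma> (\<phi> \<gamma> v) = v" if "v \<in> V" for v
      using composition_rule[OF that \<gamma>_in \<gamma>_in] id[OF that] \<gamma>(3) by simp
    show \<sigma>E: "\<phi> \<gamma> ` e \<in> E" if "e \<in> E" for e
      using fw'(3) \<gamma>_in that by (auto simp: edge_action_def)
    show "pt (\<phi> \<gamma> v) = - pt v" if "v \<in> V" for v
    proof -
      have "pt (\<phi> \<gamma> v) = - mat 1 *v pt v" using fw'(9) \<gamma>_in that \<tau>(2) by metis
      also have "\<dots> = - pt v"
        by (simp add: vec_eq_iff forall_2 mat_def matrix_vector_mult_def sum_2)
      finally show ?thesis .
    qed
    show "\<exists>v\<in>V. pt v \<noteq> 0"
    proof (rule ccontr)
      assume "\<not> ?thesis"
      then have "pt ` V \<subseteq> {0}" by auto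
      then have "affine hull (pt ` V) \<subseteq> {0}" using hull_mono[of "pt ` V" "{0}" affine] by simp
      then have "axis 1 1 \<in> {0 :: real^2}" using fw'(8) by blast
      then show False by (simp add: axis_eq_0_iff)
    qed
    show vG: "verts G = (\<lambda>v. {v, \<phi> \<gamma> v}) ` V"
      unfolding gf' orbits_def Setcompr_eq_image using orb by (rule image_cong[OF refl])
    show aG: "arcs G = (\<lambda>e. {e, \<phi> \<gamma> ` e}) ` E"
      unfolding gf' orbits_def Setcompr_eq_image using orbE by (rule image_cong[OF refl])
    show rep: "rep x \<in> x" if "x \<in> verts G" for x using gf'(4) that .
    fix a assume a: "a \<in> arcs G"
    obtain u v where uv: "{u, v} \<in> a" "tail G a = orbit \<Gamma> \<phi> u" "head G a = orbit \<Gamma> \<phi> v"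
      using gf'(3)[OF a] by blast
    have "{u, v} \<in> E" using a uv(1) \<sigma>E unfolding aG by auto
    then have uvV: "u \<in> V" "v \<in> V" using E by auto
    then show "\<exists>u v. {u, v} \<in> a \<and> tail G a = {u, \<phi> \<gamma> u} \<and> head G a = {v, \<phi> \<gamma> v}"
      using uv orb by auto
    have "rep x \<in> V" if "x = orbit \<Gamma> \<phi> w" "w \<in> V" for x w
    proof -
      have x: "x = {w, \<phi> \<gamma> w}" using that orb by simp
      then have "x \<in> verts G" using that(2) by (simp add: vG)
      from rep[OF this] have "rep x \<in> {w, \<phi> \<gamma> w}" by (subst (asm) (2) x)
      then show ?thesis using that(2) V[OF that(2)] by auto
    qed
    from this[OF uv(2) uvV(1)] this[OF uv(3) uvV(2)]
    have "rep (tail G a) \<in> V" "rep (head G a) \<in> V" by simp_all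
    moreover assume "\<phi> \<gamma> (rep (tail G a)) \<noteq> rep (tail G a)" "\<phi> \<gamma> (rep (head G a)) \<noteq> rep (head G a)"
    ultimately show "{rep (tail G a), if \<psi> a \<noteq> \<one>\<^bsub>\<Gamma>\<^esub> then \<phi> \<gamma> (rep (head G a)) else rep (head G a)} \<in> a"
      using gf'(5,6)[OF a] free id \<gamma>(1) by (auto split: if_splits)
  qed
qed

text \<open>Balance constrains only the part of \<open>H\<close> off the fixed vertices, so the
  potential is built there; this matches \<open>balanced_subgraph_bound\<close>, which asks for it
  only across arcs with two free ends.\<close>

lemma balanced_gain_subgraph_bound:
  fixes \<Gamma> :: "'g monoid" and G :: "('v set, 'v set set) pre_digraph"
  assumes "group \<Gamma>" and "order \<Gamma> = 2"
    and "half_turn_quotient V E pt \<sigma> G rep (\<lambda>a. \<psi> a \<noteq> \<one>\<^bsub>\<Gamma>\<^esub>)"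
    and \<psi>: "\<And>a. a \<in> arcs G \<Longrightarrow> \<psi> a \<in> carrier \<Gamma>"
    and X0: "X0 = {x \<in> verts G. \<sigma> (rep x) = rep x}"
    and row: "half_turn_framework.row_independent V E pt \<sigma> \<kappa>" and \<kappa>: "\<kappa> \<in> {1, - 1}"
    and nofix: "\<kappa> = 1 \<Longrightarrow> \<forall>e\<in>E. \<sigma> ` e \<noteq> e"
    and H: "subgraph H G" and ne: "arcs H \<noteq> {}" and bal: "balanced \<Gamma> \<psi> X0 H"
  shows "card (arcs H) + 3 \<le> 2 * card (verts H)"
proof -
  interpret half_turn_quotient V E pt \<sigma> G rep "\<lambda>a. \<psi> a \<noteq> \<one>\<^bsub>\<Gamma>\<^esub>" by fact
  have sub: "verts H \<subseteq> verts G" "arcs H \<subseteq> arcs G" "wf_digraph H"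
    and eq: "tail H = tail G" "head H = head G"
    using H by (auto simp: subgraph_def compatible_def)
  define H' where "H' = H \<restriction> (verts H - X0)"
  have arcs': "arcs H' = {a \<in> arcs H. tail G a \<in> verts H - X0 \<and> head G a \<in> verts H - X0}"
    and ends': "tail H' = tail G" "head H' = head G" and verts': "verts H' = verts H - X0"
    by (simp_all add: H'_def induce_subgraph_def eq)
  have wf': "wf_digraph H'" by (auto simp: wf_digraph_def arcs' ends' verts')
  have "\<exists>f :: 'v set \<Rightarrow> bool. \<forall>a\<in>arcs H'. (f (tail H' a) \<noteq> f (head H' a)) = (\<psi> a \<noteq> \<one>\<^bsub>\<Gamma>\<^esub>)"
  proof (rule potential_exists[OF _ wf'])
    show "finite (arcs H')" using finite_arcs sub(2) by (auto simp: arcs' intro: finite_subset)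
    fix w assume w: "undirected_cycle H' w"
    then have "set w \<subseteq> arcs H' \<times> UNIV"
      by (auto simp: undirected_cycle_def pre_digraph.cycle_def pre_digraph.awalk_def)
    then have "\<psi> ` fst ` set w \<subseteq> carrier \<Gamma>" using \<psi> sub(2) by (force simp: arcs')
    moreover have "walk_gain \<Gamma> \<psi> w = \<one>\<^bsub>\<Gamma>\<^esub>" using bal w by (simp add: balanced_def H'_def)
    ultimately show "even (length (filter (\<lambda>(a, d). \<psi> a \<noteq> \<one>\<^bsub>\<Gamma>\<^esub>) w))"
      using walk_gain_order_two[OF assms(1,2)] by blast
  qed
  then obtain f :: "'v set \<Rightarrow> bool"
    where f: "\<And>a. a \<in> arcs H' \<Longrightarrow> (f (tail G a) \<noteq> f (head G a)) = (\<psi> a \<noteq> \<one>\<^bsub>\<Gamma>\<^esub>)"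
    by (auto simp: ends')
  show ?thesis
  proof (rule balanced_subgraph_bound[OF row \<kappa> nofix H ne, where f = f])
    fix a assume "a \<in> arcs H" "\<sigma> (rep (tail G a)) \<noteq> rep (tail G a)"
      "\<sigma> (rep (head G a)) \<noteq> rep (head G a)"
    then show "(f (tail G a) \<noteq> f (head G a)) = (\<psi> a \<noteq> \<one>\<^bsub>\<Gamma>\<^esub>)"
      using subgraph_arc[OF H] by (intro f) (auto simp: arcs' X0)
  qed
qed

theorem proposition5p4:
  fixes \<Gamma> :: "'g monoid"
    and \<phi> :: "'g \<Rightarrow> 'v \<Rightarrow> 'v"
    and \<tau> :: "'g \<Rightarrow> real^2^2"
    and V :: "'v set" and E :: "'v set set" and pt :: "'v \<Rightarrow> real^2"
    and G :: "('v set, 'v set set) pre_digraph"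
    and rep :: "'v set \<Rightarrow> 'v" and \<psi> :: "'v set set \<Rightarrow> 'g" and p :: "'v set \<Rightarrow> real^2"
  assumes "group \<Gamma>" and "order \<Gamma> = 2"
    and "C2_symmetric_framework \<Gamma> \<phi> \<tau> V E pt"
    and "gain_framework \<Gamma> \<phi> V E pt G rep \<psi> p"
  shows
    "(symmetrically_isostatic \<Gamma> \<phi> \<tau> V E pt 0 \<longrightarrow>
        gain_tight \<Gamma> G \<psi> (fixed_orbits \<Gamma> \<phi> V) (free_orbits \<Gamma> \<phi> V) 2 0 3 1)
   \<and> (symmetrically_isostatic \<Gamma> \<phi> \<tau> V E pt 1 \<and> no_fixed_edges \<Gamma> \<phi> E \<longrightarrow>
        gain_tight \<Gamma> G \<psi> (fixed_orbits \<Gamma> \<phi> V) (free_orbits \<Gamma> \<phi> V) 2 2 3 2)"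
proof -
  obtain \<gamma> where \<gamma>: "carrier \<Gamma> = {\<one>\<^bsub>\<Gamma>\<^esub>, \<gamma>}" "\<gamma> \<noteq> \<one>\<^bsub>\<Gamma>\<^esub>" "\<gamma> \<otimes>\<^bsub>\<Gamma>\<^esub> \<gamma> = \<one>\<^bsub>\<Gamma>\<^esub>"
    by (rule order_two_group[OF assms(1,2)])
  note quot = half_turn_quotient_of_gain_framework[OF assms \<gamma>]
  interpret half_turn_quotient V E pt "\<phi> \<gamma>" G rep "\<lambda>a. \<psi> a \<noteq> \<one>\<^bsub>\<Gamma>\<^esub>" by (rule quot(1))
  define X0 where "X0 = {x \<in> verts G. \<phi> \<gamma> (rep x) = rep x}"
  define X1 where "X1 = {x \<in> verts G. \<phi> \<gamma> (rep x) \<noteq> rep x}"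
  have \<psi>: "\<psi> a \<in> carrier \<Gamma>" if "a \<in> arcs G" for a
    using assms(4) that by (simp add: gain_framework_def)
  have stab: "fixed_vertex \<Gamma> \<phi> v \<longleftrightarrow> \<phi> \<gamma> v = v" "free_vertex \<Gamma> \<phi> v \<longleftrightarrow> \<phi> \<gamma> v \<noteq> v"
    and orb: "orbit \<Gamma> \<phi> v = {v, \<phi> \<gamma> v}" if "v \<in> V" for v
    using quot(3)[OF that] \<gamma>
    by (auto simp: fixed_vertex_def free_vertex_def stabilizer_def orbit_two[OF \<gamma>(1)])
  \<comment> \<open>Being fixed is a property of the orbit, so the sets \<open>X0\<close> and
    \<open>X1\<close>, defined through representatives, are the orbits of fixed and of free
    vertices.\<close>
  have rep_orb: "\<phi> \<gamma> (rep {v, \<phi> \<gamma> v}) = rep {v, \<phi> \<gamma> v} \<longleftrightarrow> \<phi> \<gamma> v = v" if "v \<in> V" for v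
  proof -
    have "{v, \<phi> \<gamma> v} \<in> verts G" using that by (auto simp: verts_G)
    from rep[OF this] show ?thesis using \<sigma>_\<sigma>[OF that] by auto
  qed
  let ?orb = "\<lambda>v. {v, \<phi> \<gamma> v}"
  have "X0 = ?orb ` {v \<in> V. \<phi> \<gamma> v = v}" "X1 = ?orb ` {v \<in> V. \<phi> \<gamma> v \<noteq> v}"
    unfolding X0_def X1_def verts_G Compr_image_eq using rep_orb by (simp_all cong: conj_cong)
  moreover have "fixed_orbits \<Gamma> \<phi> V = ?orb ` {v \<in> V. \<phi> \<gamma> v = v}"
    "free_orbits \<Gamma> \<phi> V = ?orb ` {v \<in> V. \<phi> \<gamma> v \<noteq> v}"
    unfolding fixed_orbits_def free_orbits_def setcompr_eq_image
    using stab orb by (auto intro!: image_cong)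
  ultimately have X: "fixed_orbits \<Gamma> \<phi> V = X0" "free_orbits \<Gamma> \<phi> V = X1" by simp_all
  have mot: "symmetric_motions \<Gamma> \<phi> \<tau> V j = sym_mot (- ((- 1) ^ j))" for j
  proof -
    have "cnj (rho \<Gamma> j \<gamma>) *s (cmat (\<tau> \<gamma>) *v x) = - ((- 1) ^ j) *s x" for x
      unfolding quot(2) cmat_minus_one using \<gamma>(2) by (simp add: rho_def vec_eq_iff)
    moreover have "cnj (rho \<Gamma> j \<one>\<^bsub>\<Gamma>\<^esub>) *s (cmat (\<tau> \<one>\<^bsub>\<Gamma>\<^esub>) *v x) = x" for x
      unfolding quot(4) cmat_one by (simp add: rho_def)
    ultimately show ?thesis
      using quot(3) by (simp add: symmetric_motions_def sym_mot_def \<gamma>(1))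
  qed
  have wgt: "symmetric_weights \<Gamma> \<phi> E j = sym_wgt (- ((- 1) ^ j))" for j
  proof -
    have "edge_action \<phi> \<one>\<^bsub>\<Gamma>\<^esub> e = e" if "e \<in> E" for e
      using edge_subset[OF that] quot(3) by (force simp: edge_action_def image_iff)
    then show ?thesis using \<gamma>
      by (auto simp: symmetric_weights_def sym_wgt_def rho_def edge_action_def)
  qed
  have nofix: "\<forall>e\<in>E. \<phi> \<gamma> ` e \<noteq> e" if "no_fixed_edges \<Gamma> \<phi> E"
    using that \<gamma> by (auto simp: no_fixed_edges_def stabilizer_def edge_action_def)
  have G_self: "subgraph G G" using wf_G by (rule wf_digraph.subgraph_refl)
  have X_Int: "verts H \<inter> X1 = {x \<in> verts H. \<phi> \<gamma> (rep x) \<noteq> rep x}"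
    and X_card: "card (verts H) = card (verts H \<inter> X1) + card (verts H \<inter> X0)"
    if H: "subgraph H G" for H
  proof -
    have sub: "verts H \<subseteq> verts G" using H by auto
    then show "verts H \<inter> X1 = {x \<in> verts H. \<phi> \<gamma> (rep x) \<noteq> rep x}" by (auto simp: X1_def)
    have "finite (verts H)" using sub finite_verts by (rule finite_subset)
    moreover have "verts H = (verts H \<inter> X1) \<union> (verts H \<inter> X0)"
      using sub by (auto simp: X0_def X1_def)
    moreover have "(verts H \<inter> X1) \<inter> (verts H \<inter> X0) = {}" by (auto simp: X0_def X1_def)
    ultimately show "card (verts H) = card (verts H \<inter> X1) + card (verts H \<inter> X0)"
      by (metis card_Un_disjoint finite_Un)
  qed
  note balanced = balanced_gain_subgraph_bound[OF assms(1,2) quot(1) \<psi> X0_def]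
  have "gain_tight \<Gamma> G \<psi> X0 X1 2 0 3 1" if iso: "symmetrically_isostatic \<Gamma> \<phi> \<tau> V E pt 0"
  proof -
    have row: "row_independent (- 1)"
      and trivial: "\<forall>m\<in>sym_mot (- 1). infinitesimal_motion E pt m \<longrightarrow> trivial_motion V pt m"
      using iso by (simp_all add: symmetrically_isostatic_def mot wgt row_independent_def)
    \<comment> \<open>A free vertex is assumed instead of an arc, so that the bound serves both for
      sparsity and for the equality at a possibly arcless \<open>G\<close>.\<close>
    have upper: "card (arcs H) + 1 \<le> 2 * card (verts H \<inter> X1)"
      if "subgraph H G" "\<exists>x\<in>verts H. \<phi> \<gamma> (rep x) \<noteq> rep x" for H
      using subgraph_bound_rotation[OF row that] X_Int[OF that(1)] by simp
    have lower: "2 * card (verts G \<inter> X1) \<le> card (arcs G) + 1"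
      using arcs_lower_bound[OF _ trivial refl] X_Int[OF G_self] by simp
    have "card (arcs H) + 3 \<le> 2 * card (verts H)"
      if "subgraph H G" "arcs H \<noteq> {}" "balanced \<Gamma> \<psi> X0 H" for H
      by (rule balanced[OF _ row _ _ that]) auto
    note bal = this
    show ?thesis
      unfolding gain_tight_def gain_sparse_def
    proof (intro conjI allI impI)
      fix H assume H: "subgraph H G \<and> arcs H \<noteq> {}"
      show "int (card (arcs H)) \<le> 2 * int (card (verts H)) - 3" if "balanced \<Gamma> \<psi> X0 H"
        using bal[of H] H that by linarith
      show "int (card (arcs H)) \<le> 2 * int (card (verts H \<inter> X1)) + 0 * int (card (verts H \<inter> X0)) - 1"
        using upper[of H] ex_free_vertex[of H] H by simp
    next
      show "int (card (arcs G)) = 2 * int (card (verts G \<inter> X1)) + 0 * int (card (verts G \<inter> X0)) - 1"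
        using upper[OF G_self ex_free_vertex_G] lower by simp
    qed
  qed
  moreover have "gain_tight \<Gamma> G \<psi> X0 X1 2 2 3 2"
    if iso: "symmetrically_isostatic \<Gamma> \<phi> \<tau> V E pt 1" and "no_fixed_edges \<Gamma> \<phi> E"
  proof -
    have row: "row_independent 1"
      and trivial: "\<forall>m\<in>sym_mot 1. infinitesimal_motion E pt m \<longrightarrow> trivial_motion V pt m"
      using iso by (simp_all add: symmetrically_isostatic_def mot wgt row_independent_def)
    note nofix = nofix[OF that(2)]
    have upper: "card (arcs H) + 2 \<le> 2 * card (verts H \<inter> X1) + 2 * card (verts H \<inter> X0)"
      if "subgraph H G" "\<exists>x\<in>verts H. \<phi> \<gamma> (rep x) \<noteq> rep x" for H
      using subgraph_bound_translations[OF row nofix that(1)] that(2) X_card[OF that(1)] by auto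
    have lower: "2 * card (verts G \<inter> X1) + 2 * card (verts G \<inter> X0) \<le> card (arcs G) + 2"
      using arcs_lower_bound[OF _ trivial refl] X_card[OF G_self] by simp
    have "card (arcs H) + 3 \<le> 2 * card (verts H)"
      if "subgraph H G" "arcs H \<noteq> {}" "balanced \<Gamma> \<psi> X0 H" for H
      by (rule balanced[OF _ row _ _ that]) (use nofix in auto)
    note bal = this
    show ?thesis
      unfolding gain_tight_def gain_sparse_def
    proof (intro conjI allI impI)
      fix H assume H: "subgraph H G \<and> arcs H \<noteq> {}"
      show "int (card (arcs H)) \<le> 2 * int (card (verts H)) - 3" if "balanced \<Gamma> \<psi> X0 H"
        using bal[of H] H that by linarith
      show "int (card (arcs H)) \<le> 2 * int (card (verts H \<inter> X1)) + 2 * int (card (verts H \<inter> X0)) - 2"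
        using upper[of H] ex_free_vertex[of H] H by simp
    next
      show "int (card (arcs G)) = 2 * int (card (verts G \<inter> X1)) + 2 * int (card (verts G \<inter> X0)) - 2"
        using upper[OF G_self ex_free_vertex_G] lower by simp
    qed
  qed
  ultimately show ?thesis unfolding X by blast
qed

end
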